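(* For every integer $n>1$, the number $N^*_{root}(-n)$ of primitive integral root quadruples with least element $-n$ satisfies $$N^*_{root}(-n)=\frac n4\prod_{p\mid n}\left(1-\frac{\chi_{-4}(p)}{p}\right)+2^{\omega(n)-\delta_n-1},$$ where the product is over primes $p$ dividing $n$, $\chi_{-4}(n)=(-1)^{(n-1)/2}$ for odd $n$ and $\chi_{-4}(n)=0$ for even $n$, $\omega(n)$ denotes the number of distinct primes dividing $n$, and $\delta_n=1$ if $n\equiv2\pmod 4$ and $\delta_n=0$ otherwise.
   Context: An integer Descartes quadruple is $(a,b,c,d)\in\mathbb Z^4$ with $2(a^2+b^2+c^2+d^2)=(a+b+c+d)^2$; it is primitive if $\gcd(a,b,c,d)=1$. A Descartes quadruple with $a+b+c+d>0$ is a root quadruple if $a\le0\le b\le c\le d$ and $a+b+c\ge d$. $N^*_{root}(-n)$ is the number of primitive integer root quadruples $(a,b,c,d)$ with $a=-n$. *)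

theory Defs
  imports Complex_Main "HOL-Number_Theory.Number_Theory"
begin

type_synonym quadruple = "int \<times> int \<times> int \<times> int"

definition descartes_quadruple :: "quadruple \<Rightarrow> bool" where
  "descartes_quadruple = (\<lambda>(a, b, c, d).
     2 * (a\<^sup>2 + b\<^sup>2 + c\<^sup>2 + d\<^sup>2) = (a + b + c + d)\<^sup>2)"

definition primitive_quadruple :: "quadruple \<Rightarrow> bool" where
  "primitive_quadruple = (\<lambda>(a, b, c, d). Gcd {a, b, c, d} = 1)"

definition root_quadruple :: "quadruple \<Rightarrow> bool" where
  "root_quadruple = (\<lambda>(a, b, c, d).
     descartes_quadruple (a, b, c, d) \<and> a + b + c + d > 0 \<and>
     a \<le> 0 \<and> 0 \<le> b \<and> b \<le> c \<and> c \<le> d \<and> a + b + c \<ge> d)"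

definition N_root_star :: "int \<Rightarrow> nat" where
  "N_root_star m = card {q. root_quadruple q \<and> primitive_quadruple q \<and> fst q = m}"

definition chi_m4 :: "nat \<Rightarrow> int" where
  "chi_m4 n = (if even n then 0 else (- 1) ^ ((n - 1) div 2))"

definition omega :: "nat \<Rightarrow> nat" where
  "omega n = card {p. prime p \<and> p dvd n}"

definition delta :: "nat \<Rightarrow> nat" where
  "delta n = (if [n = 2] (mod 4) then 1 else 0)"

end

theory Submission
  imports Defs
begin

text \<open>
  Write \<open>a = -n\<close>, \<open>b = A + n\<close>, \<open>c = C + n\<close>, \<open>d = A + C + n - 2m\<close>.  Then root quadruples correspond to
  reduced binary quadratic forms \<open>(A, m, C)\<close>, \<open>0 \<le> 2m \<le> A \<le> C\<close>, of determinant \<open>AC - m\<^sup>2 = n\<^sup>2\<close>, and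
  primitive quadruples to primitive forms.  Every such form is the Gram matrix of a sublattice of
  index \<open>n\<close> of the Gaussian integers.  The sublattices with primitive Gram matrix are those of the
  form \<open>{u. n dvd det(u, \<sigma>)}\<close> for points \<open>\<sigma> = (s, t)\<close> modulo \<open>n\<close> with \<open>s\<^sup>2 + t\<^sup>2\<close> coprime to \<open>n\<close>, each
  arising from \<open>\<phi>(n)\<close> points.  A form has exactly eight realisations by pairs of Gaussian integers
  (by Hermitian descent), and a lattice has four reduced bases if its form is ambiguous and two
  otherwise.  Double counting expresses the number of forms by the number
  \<open>n \<phi>(n) \<Prod>(1 - \<chi>(p)/p)\<close> of points and by the number of ambiguous forms, and the latter is counted by
  factorizations of \<open>n\<^sup>2\<close> or \<open>(n/2)\<^sup>2\<close> into coprime factors.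
\<close>

section \<open>Representations of a form by two Gaussian integers\<close>

text \<open>The solutions of \<open>|v|\<^sup>2 = A\<close>, \<open>|w|\<^sup>2 = C\<close>, \<open>cnj v * w = m + n i\<close> in Gaussian integers
  \<open>v = p + q i\<close> and \<open>w = r + s i\<close>.\<close>
definition hsols :: "int \<Rightarrow> int \<Rightarrow> int \<Rightarrow> int \<Rightarrow> quadruple set" where
  "hsols A C m n = {(p, q, r, s). p\<^sup>2 + q\<^sup>2 = A \<and> r\<^sup>2 + s\<^sup>2 = C \<and>
     p * r + q * s = m \<and> p * s - q * r = n}"

text \<open>Exchanging \<open>v\<close> and \<open>w\<close> conjugates \<open>cnj v * w\<close>,
  which reverses the sign of \<open>n\<close>.\<close>

lemma card_hsols_swap: "card (hsols A C m n) = card (hsols C A m (- n))"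
proof -
  have "bij_betw (\<lambda>(p, q, r, s). (r, s, p, q)) (hsols A C m n) (hsols C A m (- n))"
    by (rule bij_betw_byWitness[where f' = "\<lambda>(p, q, r, s). (r, s, p, q)"])
       (auto simp: hsols_def algebra_simps)
  then show ?thesis by (rule bij_betw_same_card)
qed

text \<open>The substitution \<open>w \<mapsto> w - (k + l i) v\<close>.\<close>
lemma hsols_shift:
  assumes "(p, q, r, s) \<in> hsols A C m n"
  shows "(p, q, r - (k * p - l * q), s - (k * q + l * p)) \<in>
    hsols A (C - 2 * (k * m + l * n) + (k\<^sup>2 + l\<^sup>2) * A) (m - k * A) (n - l * A)"
proof -
  have "A = p\<^sup>2 + q\<^sup>2" "C = r\<^sup>2 + s\<^sup>2" "m = p * r + q * s" "n = p * s - q * r"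
    using assms by (auto simp: hsols_def)
  then show ?thesis
    by (simp only: hsols_def mem_Collect_eq prod.case) (simp add: algebra_simps power2_eq_square)
qed

lemma card_hsols_shift:
  "card (hsols A C m n) =
    card (hsols A (C - 2 * (k * m + l * n) + (k\<^sup>2 + l\<^sup>2) * A) (m - k * A) (n - l * A))"
    (is "_ = card ?R")
proof -
  let ?f = "\<lambda>(p, q, r, s). (p, q, r - (k * p - l * q), s - (k * q + l * p))"
  let ?g = "\<lambda>(p, q, r, s). (p, q, r + (k * p - l * q), s + (k * q + l * p))"
  have f: "?f z \<in> ?R" if "z \<in> hsols A C m n" for z
    using that by (cases z) (simp only: prod.case hsols_shift)
  have g: "?g z \<in> hsols A C m n" if "z \<in> ?R" for z
  proof (cases z)
    case (fields p q r s)
    then show ?thesis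
      using hsols_shift[of p q r s _ _ _ _ "- k" "- l", OF that[unfolded fields]]
      by (simp add: algebra_simps power2_eq_square)
  qed
  have "bij_betw ?f (hsols A C m n) ?R"
    by (rule bij_betw_byWitness[where f' = ?g])
       (use f g in \<open>force simp only: image_subset_iff split: prod.split\<close>)+
  then show ?thesis by (rule bij_betw_same_card)
qed

lemma sum_squares_eq_1_iff:
  fixes r s :: int
  shows "r\<^sup>2 + s\<^sup>2 = 1 \<longleftrightarrow> (r, s) \<in> {(1, 0), (-1, 0), (0, 1), (0, -1)}"
proof
  assume h: "r\<^sup>2 + s\<^sup>2 = 1"
  then have "r\<^sup>2 \<le> 1" "s\<^sup>2 \<le> 1"
    by (smt (verit) zero_le_power2)+
  then have "\<bar>r\<bar> \<le> 1" "\<bar>s\<bar> \<le> 1" by (simp_all add: abs_square_le_1)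
  then have "r \<in> {-1, 0, 1}" "s \<in> {-1, 0, 1}" by auto
  then show "(r, s) \<in> {(1, 0), (-1, 0), (0, 1), (0, -1)}" using h by auto
qed auto

lemma nearest_multiple:
  fixes m A :: int
  assumes "A > 0"
  obtains k where "2 * \<bar>m - k * A\<bar> \<le> A"
proof
  \<comment> \<open>\<open>?k\<close> is \<open>m / A + 1 / 2\<close> rounded down, a nearest
    integer to \<open>m / A\<close>.\<close>
  let ?k = "(2 * m + A) div (2 * A)"
  have "2 * m + A = 2 * A * ?k + (2 * m + A) mod (2 * A)"
    by simp
  moreover have "0 \<le> (2 * m + A) mod (2 * A)" "(2 * m + A) mod (2 * A) < 2 * A"
    using assms by simp_all
  ultimately show "2 * \<bar>m - ?k * A\<bar> \<le> A" by (simp add: algebra_simps abs_if)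
qed

text \<open>Reducing \<open>m + n i\<close> modulo \<open>A\<close> makes the norm of the second vector at most \<open>A/2\<close>; after a swap the
  descent continues, and it ends with a pair consisting of a zero and a unit.\<close>
lemma card_hsols:
  assumes "A \<ge> 0" "C \<ge> 0" "A * C = m\<^sup>2 + n\<^sup>2"
    and "\<And>d. d dvd A \<Longrightarrow> d dvd C \<Longrightarrow> d dvd m \<Longrightarrow> d dvd n \<Longrightarrow> is_unit d"
  shows "card (hsols A C m n) = 4"
  using assms
proof (induction "nat A" arbitrary: A C m n rule: less_induct)
  case less
  show ?case
  proof (cases "A = 0")
    case True
    then have "m = 0" "n = 0" using less.prems(3) by (auto simp: sum_power2_eq_zero_iff)
    then have "is_unit C" using less.prems(4)[of C] True by simp
    then have "C = 1" using less.prems(2) by simp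
    have "hsols A C m n = {(0, 0, 1, 0), (0, 0, -1, 0), (0, 0, 0, 1), (0, 0, 0, -1)}"
      unfolding hsols_def True \<open>m = 0\<close> \<open>n = 0\<close> \<open>C = 1\<close> sum_squares_eq_1_iff by auto
    then show ?thesis by simp
  next
    case False
    then have A: "A > 0" using less.prems(1) by simp
    obtain k where k: "2 * \<bar>m - k * A\<bar> \<le> A" using nearest_multiple[OF A] .
    obtain l where l: "2 * \<bar>n - l * A\<bar> \<le> A" using nearest_multiple[OF A] .
    define m' n' C' where "m' = m - k * A" and "n' = n - l * A"
      and "C' = C - 2 * (k * m + l * n) + (k\<^sup>2 + l\<^sup>2) * A"
    have eq: "A * C' = m'\<^sup>2 + n'\<^sup>2"
      using less.prems(3) unfolding m'_def n'_def C'_def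
      by (simp add: algebra_simps power2_eq_square)
    have "(2 * m')\<^sup>2 \<le> A\<^sup>2" "(2 * n')\<^sup>2 \<le> A\<^sup>2"
      using k l A unfolding m'_def[symmetric] n'_def[symmetric]
      by (simp_all only: abs_le_square_iff[symmetric] abs_mult abs_numeral abs_of_pos)
    then have "2 * (A * C') \<le> A * A" unfolding eq by (simp add: power2_eq_square)
    then have "A * (2 * C') \<le> A * A" by (simp add: algebra_simps)
    then have "2 * C' \<le> A" using A by simp
    moreover have "C' \<ge> 0" using eq A
      by (metis sum_power2_ge_zero zero_le_mult_iff not_less)
    ultimately have C': "0 \<le> C'" "C' < A" using A by auto
    have unit: "is_unit d" if d: "d dvd C'" "d dvd A" "d dvd m'" "d dvd - n'" for d
    proof (rule less.prems(4))
      show "d dvd A" by fact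
      have "d dvd m' + k * A" "d dvd n' + l * A" using d by auto
      then show m: "d dvd m" and n: "d dvd n" by (simp_all add: m'_def n'_def)
      have "C = C' + 2 * (k * m + l * n) - (k\<^sup>2 + l\<^sup>2) * A" by (simp add: C'_def)
      also have "d dvd \<dots>" using d m n by auto
      finally show "d dvd C" .
    qed
    have "card (hsols A C m n) = card (hsols A C' m' n')"
      unfolding C'_def m'_def n'_def by (rule card_hsols_shift)
    also have "\<dots> = card (hsols C' A m' (- n'))" by (rule card_hsols_swap)
    also have "\<dots> = 4"
      by (rule less.hyps) (use C' eq unit in \<open>auto simp: algebra_simps\<close>)
    finally show ?thesis .
  qed
qed

text \<open>The realisations of the form \<open>(A, m, C)\<close> as a Gram matrix; unlike in
  \<open>hsols\<close>, the orientation of the pair is left open.\<close>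

definition gram_sols :: "int \<Rightarrow> int \<Rightarrow> int \<Rightarrow> quadruple set" where
  "gram_sols A m C = {(p, q, r, s). p\<^sup>2 + q\<^sup>2 = A \<and> p * r + q * s = m \<and> r\<^sup>2 + s\<^sup>2 = C}"

text \<open>Lagrange's identity: \<open>A * C - m^2\<close> is the square of the determinant
  \<open>p * s - q * r\<close>.\<close>

lemma gram_det:
  assumes "(p, q, r, s) \<in> gram_sols A m C" "A * C - m\<^sup>2 = n\<^sup>2"
  shows "p * s - q * r = n \<or> p * s - q * r = - n"
proof -
  have "(p * s - q * r)\<^sup>2 = n\<^sup>2"
    using assms unfolding gram_sols_def by (auto simp: algebra_simps power2_eq_square)
  then show ?thesis by (simp add: power2_eq_iff)
qed

text \<open>The sign of the determinant splits the solutions into two disjoint sets, and primitivity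
  of the form supplies the divisor condition of \<open>card_hsols\<close>, so each has four
  elements.\<close>

lemma card_gram_sols:
  assumes "A \<ge> 0" "C \<ge> 0" "A * C - m\<^sup>2 = n\<^sup>2" "n > 0" "gcd A (gcd m C) = 1"
  shows "card (gram_sols A m C) = 8"
proof -
  have "gram_sols A m C = hsols A C m n \<union> hsols A C m (- n)"
    using gram_det[OF _ assms(3)] by (fastforce simp: gram_sols_def hsols_def)
  moreover have "hsols A C m n \<inter> hsols A C m (- n) = {}"
    using assms(4) by (auto simp: hsols_def)
  moreover have "is_unit d" if "d dvd A" "d dvd C" "d dvd m" for d
    using that assms(5) by (metis gcd_greatest)
  then have "card (hsols A C m n) = 4" "card (hsols A C m (- n)) = 4"
    using assms by (auto intro!: card_hsols)
  \<comment> \<open>An infinite set would have cardinality \<open>0\<close>.\<close>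
  moreover have "finite (hsols A C m n)" "finite (hsols A C m (- n))"
    using calculation(3,4) by (metis card.infinite zero_neq_numeral)+
  ultimately show ?thesis by (simp add: card_Un_disjoint)
qed

section \<open>Lattices attached to points modulo n\<close>

text \<open>The Gaussian integers \<open>s + t i\<close> invertible modulo \<open>n\<close>: they
  are recognised by their norm.\<close>

definition unit_points :: "int \<Rightarrow> (int \<times> int) set" where
  "unit_points n = {(s, t). s \<in> {0..<n} \<and> t \<in> {0..<n} \<and> coprime (s\<^sup>2 + t\<^sup>2) n}"

text \<open>\<open>(x, y)\<close> is parallel to the given point modulo \<open>n\<close>. For a unit
  point these vectors form a sublattice of index \<open>n\<close>.\<close>

definition in_lattice :: "int \<Rightarrow> int \<times> int \<Rightarrow> int \<Rightarrow> int \<Rightarrow> bool" where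
  "in_lattice n = (\<lambda>(s, t) x y. n dvd x * t - y * s)"

lemma not_coprime_prime_divisor:
  fixes a b :: int
  assumes "\<not> coprime a b" "b \<noteq> 0"
  obtains p where "prime p" "p dvd a" "p dvd b"
proof -
  have "gcd a b \<noteq> 0" "\<not> is_unit (gcd a b)"
    using assms by (auto simp: is_unit_gcd)
  then obtain p where "p dvd gcd a b" "prime p" using prime_divisor_exists by blast
  then show ?thesis using that by auto
qed

text \<open>Used to find a lattice vector whose norm is a unit modulo \<open>n\<close>. The
  coordinates are products of primes dividing \<open>n\<close>, chosen so that no such prime divides
  the value; where \<open>p\<close> divides both \<open>A\<close> and \<open>C\<close>, primitivity
  keeps \<open>p\<close> from dividing \<open>m\<close>.\<close>

lemma primitive_form_represents_coprime:
  fixes A m C n :: int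
  assumes "A * C - m\<^sup>2 = n\<^sup>2" "n > 0" "gcd A (gcd m C) = 1"
  obtains x y where "coprime (A * x\<^sup>2 + 2 * m * x * y + C * y\<^sup>2) n"
proof
  define P where "P = {p. prime p \<and> p dvd n}"
  have fin: "finite P" unfolding P_def
    using assms(2) finite_divisors_int[of n] by (metis (no_types, lifting) finite_subset mem_Collect_eq subsetI less_int_code(1))
  \<comment> \<open>Modulo each prime \<open>p\<close> dividing \<open>n\<close> only one of the terms \<open>A x\<^sup>2\<close>, \<open>C y\<^sup>2\<close>, \<open>2 m x y\<close> survives.\<close>
  define x where "x = \<Prod>{p \<in> P. p dvd A \<and> \<not> p dvd C}"
  define y where "y = \<Prod>{p \<in> P. \<not> p dvd A}"
  have dvd_prod: "p dvd \<Prod>S \<longleftrightarrow> p \<in> S" if "p \<in> P" "S \<subseteq> P" for p S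
  proof
    have S: "finite S" using that(2) fin by (rule finite_subset)
    have p: "prime p" using that(1) by (simp add: P_def)
    show "p dvd \<Prod>S" if "p \<in> S" using S that by (rule dvd_prodI)
    assume "p dvd \<Prod>S"
    then obtain q where q: "q \<in> S" "p dvd q"
      using prime_dvd_prod_iff[OF S p, of "\<lambda>x. x"] by auto
    then have "prime q" using that(2) by (auto simp: P_def)
    then show "p \<in> S" using q p primes_dvd_imp_eq by blast
  qed
  show "coprime (A * x\<^sup>2 + 2 * m * x * y + C * y\<^sup>2) n"
  proof (rule ccontr)
    assume "\<not> ?thesis"
    then obtain p where p: "prime p" "p dvd A * x\<^sup>2 + 2 * m * x * y + C * y\<^sup>2" "p dvd n"
      using not_coprime_prime_divisor[of _ n] assms(2) by (metis less_irrefl)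
    note pp = prime_dvd_mult_iff[OF p(1)] prime_dvd_power_iff[OF p(1)]
    have "p \<in> P" using p by (simp add: P_def)
    have x: "p dvd x \<longleftrightarrow> p dvd A \<and> \<not> p dvd C"
      unfolding x_def using \<open>p \<in> P\<close> by (subst dvd_prod) auto
    have y: "p dvd y \<longleftrightarrow> \<not> p dvd A"
      unfolding y_def using \<open>p \<in> P\<close> by (subst dvd_prod) auto
    show False
    proof (cases "p dvd A")
      case False
      then have "p dvd y" "\<not> p dvd x" using x y by auto
      then have "p dvd A * x\<^sup>2"
        using p(2) by (simp add: dvd_add_left_iff power2_eq_square)
      then show False using False \<open>\<not> p dvd x\<close> p(1) by (simp add: pp)
    next
      case True
      then have ny: "\<not> p dvd y" using y by auto
      show False
      proof (cases "p dvd C")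
        case False
        then have "p dvd x" using x True by auto
        then have "p dvd C * y\<^sup>2"
          using p(2) by (simp add: dvd_add_right_iff power2_eq_square)
        then show False using False ny p(1) by (simp add: pp)
      next
        case C: True
        then have "\<not> p dvd x" using x True by auto
        have "p dvd 2 * m * x * y"
          using p(2) True C by (simp add: dvd_add_right_iff dvd_add_left_iff)
        moreover have "\<not> p dvd m"
          using assms(3) True C p(1) by (metis gcd_greatest not_prime_unit)
        ultimately have "p dvd 2" using ny \<open>\<not> p dvd x\<close> p(1) by (simp add: pp)
        \<comment> \<open>The factor 2 of the middle coefficient is the last obstruction:
          \<open>A\<close>, \<open>C\<close>, \<open>n\<close> are even and \<open>m\<close> is odd,
          so \<open>A * C - m^2\<close> is \<open>-1\<close> modulo 4 while \<open>n^2\<close> is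
          \<open>0\<close>.\<close>
        then have "p = 2" using p(1) by (intro primes_dvd_imp_eq) auto
        then obtain a c b k where *: "A = 2 * a" "C = 2 * c" "n = 2 * k" "m = 2 * b + 1"
          using True C p(3) \<open>\<not> p dvd m\<close> by (metis dvd_def oddE)
        have "4 * (a * c) - 4 * (b * b + b) - 1 = 4 * (k * k)"
          using assms(1) unfolding * by (simp add: algebra_simps power2_eq_square)
        then show False by presburger
      qed
    qed
  qed
qed

text \<open>The multiplier is that of the orthogonal projection of \<open>(s, t)\<close> to
  \<open>(g, h)\<close>, namely \<open>s * g + t * h\<close> divided by the norm of
  \<open>(g, h)\<close>, which is invertible modulo \<open>n\<close>.\<close>

lemma cong_mult_of_cross:
  fixes g h s t n :: int
  assumes "coprime (g\<^sup>2 + h\<^sup>2) n" "n dvd g * t - h * s"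
  obtains k where "[s = k * g] (mod n)" "[t = k * h] (mod n)"
proof -
  obtain i where i: "[(g\<^sup>2 + h\<^sup>2) * i = 1] (mod n)"
    using assms(1) cong_solve_coprime_int by blast
  obtain c where c: "g * t - h * s = n * c" using assms(2) by auto
  obtain d where d: "(g\<^sup>2 + h\<^sup>2) * i - 1 = n * d"
    using i by (metis cong_iff_dvd_diff dvd_def)
  have "s - (s * g + t * h) * i * g = n * (- s * d - c * h * i)"
  proof -
    have "s - (s * g + t * h) * i * g =
        - s * ((g\<^sup>2 + h\<^sup>2) * i - 1) - (g * t - h * s) * h * i"
      by (simp add: algebra_simps power2_eq_square)
    then show ?thesis unfolding c d by (simp add: algebra_simps)
  qed
  moreover have "t - (s * g + t * h) * i * h = n * (- t * d + c * g * i)"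
  proof -
    have "t - (s * g + t * h) * i * h =
        - t * ((g\<^sup>2 + h\<^sup>2) * i - 1) + (g * t - h * s) * g * i"
      by (simp add: algebra_simps power2_eq_square)
    then show ?thesis unfolding c d by (simp add: algebra_simps)
  qed
  ultimately show ?thesis
    by (intro that[of "(s * g + t * h) * i"]) (simp_all add: cong_iff_dvd_diff)
qed

text \<open>\<open>totatives n\<close> is taken from \<open>{0<..n}\<close>, not from
  \<open>{0..<n}\<close>; for \<open>n > 1\<close> neither \<open>0\<close> nor \<open>n\<close> is
  coprime to \<open>n\<close>.\<close>

lemma card_coprime_residues:
  assumes "n > 1"
  shows "card {k \<in> {0..<int n}. coprime k (int n)} = totient n"
proof -
  have "bij_betw int (totatives n) {k \<in> {0..<int n}. coprime k (int n)}"
  proof (rule bij_betw_byWitness[where f' = nat])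
    show "int ` totatives n \<subseteq> {k \<in> {0..<int n}. coprime k (int n)}"
      using assms by (auto simp: totatives_def le_less)
    show "nat ` {k \<in> {0..<int n}. coprime k (int n)} \<subseteq> totatives n"
    proof clarify
      fix k assume k: "k \<in> {0..<int n}" "coprime k (int n)"
      then have "k \<noteq> 0" using assms by auto
      moreover have "coprime (nat k) n"
        using k by (metis atLeastLessThan_iff coprime_int_iff nat_0_le)
      ultimately show "nat k \<in> totatives n" using k by (auto simp: totatives_def)
    qed
  qed auto
  then show ?thesis unfolding totient_def by (metis bij_betw_same_card)
qed

text \<open>The two vectors span a vector \<open>(g, h)\<close> whose norm is a unit modulo
  \<open>n\<close>. A unit point whose lattice contains both vectors is parallel to
  \<open>(g, h)\<close>, so these points are the unit multiples of \<open>(g, h)\<close> modulo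
  \<open>n\<close>.\<close>

lemma card_points_of_lattice:
  fixes n :: nat
  assumes "n > 1" and P: "(p, q, r, s) \<in> gram_sols A m C"
    and AC: "A * C - m\<^sup>2 = (int n)\<^sup>2" and prim: "gcd A (gcd m C) = 1"
  shows "card {\<sigma> \<in> unit_points (int n). in_lattice (int n) \<sigma> p q \<and> in_lattice (int n) \<sigma> r s} = totient n"
    (is "card ?S = _")
proof -
  define N where "N = int n"
  have N: "N > 1" using assms(1) by (simp add: N_def)
  obtain x y where xy: "coprime (A * x\<^sup>2 + 2 * m * x * y + C * y\<^sup>2) N"
    using primitive_form_represents_coprime[OF AC _ prim] assms(1) unfolding N_def by auto
  define g h where "g = x * p + y * r" and "h = x * q + y * s"
  have "g\<^sup>2 + h\<^sup>2 = A * x\<^sup>2 + 2 * m * x * y + C * y\<^sup>2"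
    using P unfolding gram_sols_def g_def h_def by (auto simp: algebra_simps power2_eq_square)
  then have gh: "coprime (g\<^sup>2 + h\<^sup>2) N" using xy by simp
  have det: "N dvd p * s - q * r" using gram_det[OF P AC] by (auto simp: N_def)
  have mult: "(k * g)\<^sup>2 + (k * h)\<^sup>2 = k\<^sup>2 * (g\<^sup>2 + h\<^sup>2)" for k
    by (simp add: algebra_simps power2_eq_square)
  \<comment> \<open>The norm of \<open>(k * g, k * h)\<close> is \<open>k^2\<close> times a unit, so
    exactly the units \<open>k\<close> give unit points.\<close>
  have cop: "coprime ((k * g mod N)\<^sup>2 + (k * h mod N)\<^sup>2) N \<longleftrightarrow> coprime k N" for k
  proof -
    have "[(k * g mod N)\<^sup>2 + (k * h mod N)\<^sup>2 = (k * g)\<^sup>2 + (k * h)\<^sup>2] (mod N)"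
      by (intro cong_add cong_pow) (simp_all add: cong_def)
    then have "coprime ((k * g mod N)\<^sup>2 + (k * h mod N)\<^sup>2) N \<longleftrightarrow> coprime ((k * g)\<^sup>2 + (k * h)\<^sup>2) N"
      by (metis cong_imp_coprime cong_sym)
    then show ?thesis unfolding mult using gh by simp
  qed
  \<comment> \<open>The determinant of either vector with \<open>(g, h)\<close> is a multiple of the
    determinant of the two vectors, which is \<open>n\<close> up to sign.\<close>
  have lat: "N dvd p * (k * h mod N) - q * (k * g mod N)"
    "N dvd r * (k * h mod N) - s * (k * g mod N)" for k
  proof -
    have "[p * (k * h mod N) - q * (k * g mod N) = p * (k * h) - q * (k * g)] (mod N)"
      "[r * (k * h mod N) - s * (k * g mod N) = r * (k * h) - s * (k * g)] (mod N)"
      by (intro cong_diff cong_mult; simp add: cong_def)+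
    moreover have "p * (k * h) - q * (k * g) = (p * s - q * r) * (k * y)"
      "r * (k * h) - s * (k * g) = (p * s - q * r) * (- k * x)"
      by (simp_all add: g_def h_def algebra_simps)
    ultimately show "N dvd p * (k * h mod N) - q * (k * g mod N)"
      "N dvd r * (k * h mod N) - s * (k * g mod N)"
      using det by (metis cong_dvd_iff dvd_mult2)+
  qed
  have "bij_betw (\<lambda>k. (k * g mod N, k * h mod N)) {k \<in> {0..<N}. coprime k N} ?S"
  proof (rule bij_betw_imageI)
    show "inj_on (\<lambda>k. (k * g mod N, k * h mod N)) {k \<in> {0..<N}. coprime k N}"
    proof (rule inj_onI)
      fix k l assume k: "k \<in> {k \<in> {0..<N}. coprime k N}" and l: "l \<in> {k \<in> {0..<N}. coprime k N}"
        and "(k * g mod N, k * h mod N) = (l * g mod N, l * h mod N)"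
      then have "[k * g = l * g] (mod N)" "[k * h = l * h] (mod N)" by (simp_all add: cong_def)
      \<comment> \<open>Only the norm of \<open>(g, h)\<close> is known to be invertible, so the
        congruences are weighted by \<open>g\<close> and \<open>h\<close> and added.\<close>
      then have "[k * g * g + k * h * h = l * g * g + l * h * h] (mod N)"
        by (meson cong_add cong_mult cong_refl)
      then have "[k * (g\<^sup>2 + h\<^sup>2) = l * (g\<^sup>2 + h\<^sup>2)] (mod N)"
        by (simp add: algebra_simps power2_eq_square)
      then have "[k = l] (mod N)" using gh by (simp add: cong_mult_rcancel)
      then show "k = l" using k l by (auto simp: cong_def)
    qed
    show "(\<lambda>k. (k * g mod N, k * h mod N)) ` {k \<in> {0..<N}. coprime k N} = ?S"
    proof (rule antisym)
      show "(\<lambda>k. (k * g mod N, k * h mod N)) ` {k \<in> {0..<N}. coprime k N} \<subseteq> ?S"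
        using N cop lat by (auto simp: unit_points_def in_lattice_def N_def[symmetric])
      show "?S \<subseteq> (\<lambda>k. (k * g mod N, k * h mod N)) ` {k \<in> {0..<N}. coprime k N}"
      proof clarify
        fix a b assume ab: "(a, b) \<in> unit_points (int n)" "in_lattice (int n) (a, b) p q"
          "in_lattice (int n) (a, b) r s"
        have "g * b - h * a = x * (p * b - q * a) + y * (r * b - s * a)"
          by (simp add: g_def h_def algebra_simps)
        then have "N dvd g * b - h * a"
          using ab(2,3) unfolding in_lattice_def N_def by (simp add: dvd_add)
        then obtain k where k: "[a = k * g] (mod N)" "[b = k * h] (mod N)"
          using cong_mult_of_cross[OF gh] by blast
        have *: "a = (k mod N) * g mod N" "b = (k mod N) * h mod N"
          using k ab(1) by (auto simp: unit_points_def cong_def N_def mod_simps)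
        moreover have "coprime (k mod N) N"
          using ab(1) cop[of "k mod N"] unfolding *[symmetric]
          by (simp add: unit_points_def N_def)
        ultimately show "(a, b) \<in> (\<lambda>k. (k * g mod N, k * h mod N)) ` {k \<in> {0..<N}. coprime k N}"
          using N by (intro image_eqI[of _ _ "k mod N"]) auto
      qed
    qed
  qed
  then have "card ?S = card {k \<in> {0..<N}. coprime k N}" by (simp add: bij_betw_same_card)
  then show ?thesis using card_coprime_residues[OF assms(1)] by (simp add: N_def)
qed

section \<open>Reduced bases\<close>

text \<open>\<open>(A, m, C)\<close> stands for \<open>A x^2 + 2 m x y + C y^2\<close>. Requiring
  \<open>m\<close> to be nonnegative fits bases of either orientation, that is, equivalence under
  GL2(Z).\<close>

definition reduced_forms :: "int \<Rightarrow> (int \<times> int \<times> int) set" where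
  "reduced_forms n = {(A, m, C). 0 \<le> m \<and> 2 * m \<le> A \<and> A \<le> C \<and>
     A * C - m\<^sup>2 = n\<^sup>2 \<and> gcd A (gcd m C) = 1}"

text \<open>For a unit point and a form of determinant \<open>n^2\<close>, spanning is automatic
  because the lattice has index \<open>n\<close>; see \<open>lattice_combination\<close>.\<close>

definition lattice_bases :: "int \<Rightarrow> int \<times> int \<Rightarrow> int \<times> int \<times> int \<Rightarrow> quadruple set" where
  "lattice_bases n \<sigma> = (\<lambda>(A, m, C). {(p, q, r, s).
     (p, q, r, s) \<in> gram_sols A m C \<and> in_lattice n \<sigma> p q \<and> in_lattice n \<sigma> r s})"

text \<open>Two vectors parallel to the same unit point modulo \<open>n\<close> are parallel to each
  other: the norm of the point times their determinant is a combination of their determinants with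
  the point.\<close>

lemma lattice_det_dvd:
  assumes "coprime (s\<^sup>2 + t\<^sup>2) n" "in_lattice n (s, t) x y" "in_lattice n (s, t) z u"
  shows "n dvd x * u - y * z"
proof -
  have "(s\<^sup>2 + t\<^sup>2) * (x * u - y * z) =
      (x * t - y * s) * (z * s + u * t) - (x * s + y * t) * (z * t - u * s)"
    by (simp add: algebra_simps power2_eq_square)
  moreover have "n dvd \<dots>" using assms(2,3) by (auto simp: in_lattice_def)
  ultimately show ?thesis using assms(1)
    by (metis coprime_commute coprime_dvd_mult_right_iff)
qed

text \<open>Cramer's rule: the numerators are divisible by \<open>n\<close>, and the denominator is
  \<open>n\<close> up to sign.\<close>

lemma lattice_combination:
  assumes "coprime (s\<^sup>2 + t\<^sup>2) n" "n > 0"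
    and "in_lattice n (s, t) p q" "in_lattice n (s, t) r w" "p * w - q * r = n \<or> p * w - q * r = - n"
    and "in_lattice n (s, t) x y"
  obtains k l where "x = k * p + l * r" "y = k * q + l * w"
proof -
  define D where "D = p * w - q * r"
  have D: "D dvd n" "n dvd D" "D \<noteq> 0" using assms(2,5) by (auto simp: D_def)
  obtain k where k: "x * w - y * r = D * k"
    using lattice_det_dvd[OF assms(1,6,4)] D(1) by (meson dvdE dvd_trans)
  obtain l where l: "p * y - q * x = D * l"
    using lattice_det_dvd[OF assms(1,3,6)] D(1) by (meson dvdE dvd_trans)
  have "D * x = D * (k * p + l * r)"
  proof -
    have "D * x = (x * w - y * r) * p + (p * y - q * x) * r" by (simp add: D_def algebra_simps)
    then show ?thesis unfolding k l by (simp add: algebra_simps)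
  qed
  moreover have "D * y = D * (k * q + l * w)"
  proof -
    have "D * y = (x * w - y * r) * q + (p * y - q * x) * w" by (simp add: D_def algebra_simps)
    then show ?thesis unfolding k l by (simp add: algebra_simps)
  qed
  ultimately show ?thesis using D(3) that by simp
qed

section \<open>Existence of a reduced basis\<close>

text \<open>Dividing the point by the gcd of its coordinates gives a primitive lattice vector
  \<open>(p, q)\<close>; Bezout completes it to determinant 1, and \<open>n\<close> times the second
  vector lies in every such lattice.\<close>

lemma lattice_has_basis:
  assumes "coprime (s\<^sup>2 + t\<^sup>2) n" "n > 1"
  obtains p q r w where "in_lattice n (s, t) p q" "in_lattice n (s, t) r w" "p * w - q * r = n"
proof -
  define d where "d = gcd s t"
  have "d \<noteq> 0" using assms by (auto simp: d_def)
  then obtain p q where pq: "s = p * d" "t = q * d" "coprime p q"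
    unfolding d_def using gcd_coprime_exists by blast
  then obtain x y where xy: "p * x + q * y = 1"
    using bezout_int[of p q] by (metis coprime_imp_gcd_eq_1 mult.commute)
  show ?thesis
  proof (rule that)
    show "in_lattice n (s, t) p q" by (simp add: in_lattice_def pq)
    show "in_lattice n (s, t) (- n * y) (n * x)" by (simp add: in_lattice_def)
    show "p * (n * x) - q * (- n * y) = n"
      using arg_cong[OF xy, of "\<lambda>z. n * z"] by (simp add: algebra_simps)
  qed
qed

lemma in_lattice_add_mult:
  assumes "in_lattice n \<sigma> x y" "in_lattice n \<sigma> z u"
  shows "in_lattice n \<sigma> (x + k * z) (y + k * u)"
proof -
  obtain s t where \<sigma>: "\<sigma> = (s, t)" by (cases \<sigma>)
  have "(x + k * z) * t - (y + k * u) * s = (x * t - y * s) + k * (z * t - u * s)"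
    by (simp add: algebra_simps)
  then show ?thesis using assms by (simp add: in_lattice_def \<sigma>)
qed

text \<open>Lagrange-Gauss reduction, with minimality in place of an algorithm. The form is
  primitive because a prime dividing \<open>A\<close>, \<open>m\<close> and \<open>C\<close> would
  divide \<open>n\<close> and the norm of every lattice vector.\<close>

lemma lattice_has_reduced_basis:
  assumes "coprime (s\<^sup>2 + t\<^sup>2) n" "n > 1"
  obtains T where "T \<in> reduced_forms n" "lattice_bases n (s, t) T \<noteq> {}"
proof -
  let ?lat = "in_lattice n (s, t)"
  define B where "B = (\<lambda>(p, q, r, w). ?lat p q \<and> ?lat r w \<and>
    (p * w - q * r = n \<or> p * w - q * r = - n))"
  define \<mu> where "\<mu> = (\<lambda>(p::int, q::int, r::int, w::int). nat (p\<^sup>2 + q\<^sup>2 + r\<^sup>2 + w\<^sup>2))"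
  \<comment> \<open>A basis minimising the sum of the squared lengths is reduced up to order and sign.\<close>
  obtain z0 where "B z0"
  proof (rule lattice_has_basis[OF assms])
    fix p q r w assume "?lat p q" "?lat r w" "p * w - q * r = n"
    then show thesis using that[of "(p, q, r, w)"] by (simp add: B_def)
  qed
  then obtain z where z: "B z" "\<And>z'. B z' \<Longrightarrow> \<mu> z \<le> \<mu> z'"
    using arg_min_natI[of B z0 \<mu>] arg_min_nat_le[of B _ \<mu>] by blast
  obtain p q r w where zz: "z = (p, q, r, w)" by (cases z)
  have lat: "?lat p q" "?lat r w" and det: "p * w - q * r = n \<or> p * w - q * r = - n"
    using z(1) by (auto simp: B_def zz)
  have min: "p\<^sup>2 + q\<^sup>2 + r\<^sup>2 + w\<^sup>2 \<le> p'\<^sup>2 + q'\<^sup>2 + r'\<^sup>2 + w'\<^sup>2"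
    if "B (p', q', r', w')" for p' q' r' w'
    using z(2)[OF that] unfolding \<mu>_def zz prod.case
    by (subst (asm) nat_le_eq_zle) (auto intro!: add_nonneg_nonneg)
  define A m C where "A = p\<^sup>2 + q\<^sup>2" and "m = p * r + q * w" and "C = r\<^sup>2 + w\<^sup>2"
  have "B (p, q, r + e * p, w + e * q)" "B (p + e * r, q + e * w, r, w)" for e
  proof -
    have "p * (w + e * q) - q * (r + e * p) = p * w - q * r"
      "(p + e * r) * w - (q + e * w) * r = p * w - q * r" by (simp_all add: algebra_simps)
    then show "B (p, q, r + e * p, w + e * q)" "B (p + e * r, q + e * w, r, w)"
      using lat det by (simp_all add: B_def in_lattice_add_mult)
  qed
  \<comment> \<open>Adding one basis vector to the other, or subtracting it, does not shorten a
    minimal basis; this bounds \<open>2 * m\<close> in absolute value by \<open>A\<close> and by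
    \<open>C\<close>.\<close>
  from this[of 1] this[of "-1"] have *: "B (p, q, r - p, w - q)" "B (p, q, r + p, w + q)"
    "B (p - r, q - w, r, w)" "B (p + r, q + w, r, w)" by simp_all
  have mA: "2 * \<bar>m\<bar> \<le> A" "2 * \<bar>m\<bar> \<le> C"
    using *[THEN min] by (simp_all add: A_def m_def C_def algebra_simps power2_eq_square abs_if)
  have AC: "A * C - m\<^sup>2 = n\<^sup>2"
  proof -
    have "A * C - m\<^sup>2 = (p * w - q * r)\<^sup>2"
      by (simp add: A_def m_def C_def algebra_simps power2_eq_square)
    then show ?thesis using det by auto
  qed
  have prim: "gcd A (gcd m C) = 1"
  proof (rule ccontr)
    assume "gcd A (gcd m C) \<noteq> 1"
    then have "\<not> coprime A (gcd m C)" by (simp add: coprime_iff_gcd_eq_1)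
    moreover have "gcd m C \<noteq> 0" using AC assms(2) by auto
    ultimately obtain d where d: "prime d" "d dvd A" "d dvd gcd m C"
      by (rule not_coprime_prime_divisor)
    then have dd: "d dvd A" "d dvd m" "d dvd C" by auto
    then have "d dvd A * C - m\<^sup>2" by (simp add: power2_eq_square)
    then have "d dvd n" using AC d(1) by (metis prime_dvd_power)
    \<comment> \<open>The point lies in its own lattice, and its norm is coprime to
      \<open>n\<close>.\<close>
    have "?lat s t" by (simp add: in_lattice_def)
    then obtain k l where kl: "s = k * p + l * r" "t = k * q + l * w"
      using lattice_combination[OF assms(1) _ lat det, of s t thesis] assms(2) by auto
    have "s\<^sup>2 + t\<^sup>2 = A * k\<^sup>2 + m * (2 * k * l) + C * l\<^sup>2"
      unfolding kl A_def m_def C_def by (simp add: algebra_simps power2_eq_square)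
    then have "d dvd s\<^sup>2 + t\<^sup>2" using dd by simp
    then show False using \<open>d dvd n\<close> assms(1) d(1) by (metis coprime_common_divisor not_prime_unit)
  qed
  \<comment> \<open>Reversing the first vector makes the inner product nonnegative.\<close>
  define \<epsilon> where "\<epsilon> = (if m \<ge> 0 then 1 else - 1 :: int)"
  have \<epsilon>: "\<epsilon> * m = \<bar>m\<bar>" "\<epsilon> * \<epsilon> = 1" by (auto simp: \<epsilon>_def)
  have lat': "?lat (\<epsilon> * p) (\<epsilon> * q)" using lat by (auto simp: \<epsilon>_def in_lattice_def dvd_diff_commute)
  have gram: "(\<epsilon> * p)\<^sup>2 + (\<epsilon> * q)\<^sup>2 = A" "(\<epsilon> * p) * r + (\<epsilon> * q) * w = \<bar>m\<bar>"
    using \<epsilon> by (auto simp: A_def m_def algebra_simps power2_eq_square \<epsilon>_def)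
  show ?thesis
  proof (cases "A \<le> C")
    case True
    show ?thesis
    proof (rule that)
      show "(A, \<bar>m\<bar>, C) \<in> reduced_forms n"
        using mA True AC prim by (simp add: reduced_forms_def)
      have "(\<epsilon> * p, \<epsilon> * q, r, w) \<in> lattice_bases n (s, t) (A, \<bar>m\<bar>, C)"
        using lat lat' gram by (simp add: lattice_bases_def gram_sols_def C_def)
      then show "lattice_bases n (s, t) (A, \<bar>m\<bar>, C) \<noteq> {}" by blast
    qed
  next
    case False
    show ?thesis
    proof (rule that)
      show "(C, \<bar>m\<bar>, A) \<in> reduced_forms n"
        using mA False AC prim by (simp add: reduced_forms_def algebra_simps gcd.commute gcd.left_commute)
      have "(r, w, \<epsilon> * p, \<epsilon> * q) \<in> lattice_bases n (s, t) (C, \<bar>m\<bar>, A)"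
        using lat lat' gram by (simp add: lattice_bases_def gram_sols_def C_def algebra_simps)
      then show "lattice_bases n (s, t) (C, \<bar>m\<bar>, A) \<noteq> {}" by blast
    qed
  qed
qed

section \<open>Minima of a reduced form and uniqueness\<close>

text \<open>Since \<open>2 * m <= A\<close>, the value is at least
  \<open>A X^2 - A X Y + C Y^2\<close> with \<open>X\<close>, \<open>Y\<close> the absolute values.
  For \<open>X >= Y\<close> the first two terms are nonnegative together; for \<open>X < Y\<close>
  one may replace \<open>A\<close> by \<open>C\<close>, and \<open>X^2 - X Y + Y^2\<close> is at
  least 1.\<close>

lemma reduced_form_ge:
  fixes A m C x y :: int
  assumes "0 \<le> m" "2 * m \<le> A" "A \<le> C" "y \<noteq> 0"
  shows "C \<le> A * x\<^sup>2 + 2 * m * x * y + C * y\<^sup>2"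
proof -
  define X Y where "X = \<bar>x\<bar>" and "Y = \<bar>y\<bar>"
  have Y: "Y \<ge> 1" "X \<ge> 0" using assms(4) by (simp_all add: X_def Y_def)
  have "2 * m * (X * Y) \<le> A * (X * Y)" using Y assms(2) by (intro mult_right_mono) auto
  moreover have "- (2 * m * (X * Y)) \<le> 2 * m * x * y"
  proof -
    have "- (X * Y) \<le> x * y" unfolding X_def Y_def abs_mult[symmetric] by simp
    then have "2 * m * (- (X * Y)) \<le> 2 * m * (x * y)" using assms(1) by (intro mult_left_mono) auto
    then show ?thesis by (simp add: algebra_simps)
  qed
  ultimately have 1: "A * X\<^sup>2 - A * (X * Y) + C * Y\<^sup>2 \<le> A * x\<^sup>2 + 2 * m * x * y + C * y\<^sup>2"
    by (simp add: X_def Y_def)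
  have "C \<le> A * X\<^sup>2 - A * (X * Y) + C * Y\<^sup>2"
  proof (cases "X \<ge> Y")
    case True
    then have "0 \<le> A * (X * (X - Y))" using Y assms by (intro mult_nonneg_nonneg) auto
    moreover have "C * 1 \<le> C * Y\<^sup>2" using Y assms by (intro mult_left_mono) auto
    ultimately show ?thesis by (simp add: algebra_simps power2_eq_square)
  next
    case False
    then have "A * (X * (Y - X)) \<le> C * (X * (Y - X))" using Y assms by (intro mult_right_mono) auto
    moreover have "1 \<le> X\<^sup>2 - X * Y + Y\<^sup>2"
    proof -
      have "1 * 1 \<le> Y * (Y - X)" using False Y by (intro mult_mono) auto
      then have "1 \<le> Y * Y - X * Y" by (simp add: algebra_simps)
      moreover have "0 \<le> X * X" by simp
      ultimately show ?thesis unfolding power2_eq_square by linarith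
    qed
    then have "C * 1 \<le> C * (X\<^sup>2 - X * Y + Y\<^sup>2)" using assms by (intro mult_left_mono) auto
    ultimately show ?thesis by (simp add: algebra_simps power2_eq_square)
  qed
  then show ?thesis using 1 by linarith
qed

lemma reduced_form_ge_min:
  fixes A m C x y :: int
  assumes "0 \<le> m" "2 * m \<le> A" "A \<le> C" "x \<noteq> 0 \<or> y \<noteq> 0"
  shows "A \<le> A * x\<^sup>2 + 2 * m * x * y + C * y\<^sup>2"
proof (cases "y = 0")
  case True
  then have "1 \<le> x\<^sup>2" using assms(4) by (simp add: int_one_le_iff_zero_less)
  then have "A * 1 \<le> A * x\<^sup>2" using assms by (intro mult_left_mono) auto
  then show ?thesis using True by simp
next
  case False
  then show ?thesis using reduced_form_ge[OF assms(1-3) False, of x] assms(3) by linarith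
qed

lemma gram_change_basis:
  fixes p q r w x y z u :: int
  assumes "(p, q, r, w) \<in> gram_sols A m C"
    and "(x * p + y * r, x * q + y * w, z * p + u * r, z * q + u * w) \<in> gram_sols A' m' C'"
  shows "A' = A * x\<^sup>2 + 2 * m * x * y + C * y\<^sup>2"
    and "C' = A * z\<^sup>2 + 2 * m * z * u + C * u\<^sup>2"
    and "m' = A * x * z + m * (x * u + y * z) + C * y * u"
proof -
  have "A = p\<^sup>2 + q\<^sup>2" "m = p * r + q * w" "C = r\<^sup>2 + w\<^sup>2"
    and "A' = (x * p + y * r)\<^sup>2 + (x * q + y * w)\<^sup>2"
    and "C' = (z * p + u * r)\<^sup>2 + (z * q + u * w)\<^sup>2"
    and "m' = (x * p + y * r) * (z * p + u * r) + (x * q + y * w) * (z * q + u * w)"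
    using assms unfolding gram_sols_def mem_Collect_eq prod.case by metis+
  then show "A' = A * x\<^sup>2 + 2 * m * x * y + C * y\<^sup>2"
    and "C' = A * z\<^sup>2 + 2 * m * z * u + C * u\<^sup>2"
    and "m' = A * x * z + m * (x * u + y * z) + C * y * u"
    by (simp_all only:) (simp_all add: algebra_simps power2_eq_square)
qed

text \<open>Each new vector is an integral combination of the old ones, and both bases have
  determinant \<open>n\<close> up to sign, so the transition matrix has determinant 1 or -1.\<close>

lemma lattice_bases_related:
  assumes "coprime (fst \<sigma> ^ 2 + snd \<sigma> ^ 2) n" "n > 0" "T \<in> reduced_forms n" "T' \<in> reduced_forms n"
    and "(p, q, r, w) \<in> lattice_bases n \<sigma> T" "(p', q', r', w') \<in> lattice_bases n \<sigma> T'"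
  obtains x y z u where "p' = x * p + y * r" "q' = x * q + y * w"
    "r' = z * p + u * r" "w' = z * q + u * w" "x * u - y * z = 1 \<or> x * u - y * z = -1"
proof -
  obtain A m C where T: "T = (A, m, C)" by (cases T)
  obtain A' m' C' where T': "T' = (A', m', C')" by (cases T')
  obtain s t where \<sigma>: "\<sigma> = (s, t)" by (cases \<sigma>)
  have det: "p * w - q * r = n \<or> p * w - q * r = - n"
    using assms by (intro gram_det[of p q r w A m C]) (auto simp: T reduced_forms_def lattice_bases_def)
  have det': "p' * w' - q' * r' = n \<or> p' * w' - q' * r' = - n"
    using assms by (intro gram_det[of p' q' r' w' A' m' C']) (auto simp: T' reduced_forms_def lattice_bases_def)
  have lat: "in_lattice n (s, t) p q" "in_lattice n (s, t) r w"
    "in_lattice n (s, t) p' q'" "in_lattice n (s, t) r' w'"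
    using assms(5,6) by (auto simp: lattice_bases_def T T' \<sigma>)
  obtain x y where 1: "p' = x * p + y * r" "q' = x * q + y * w"
    using lattice_combination[OF _ assms(2) lat(1,2) det lat(3)] assms(1) \<sigma> by auto
  obtain z u where 2: "r' = z * p + u * r" "w' = z * q + u * w"
    using lattice_combination[OF _ assms(2) lat(1,2) det lat(4)] assms(1) \<sigma> by auto
  define D e where "D = p * w - q * r" and "e = x * u - y * z"
  have "p' * w' - q' * r' = e * D"
    unfolding 1 2 D_def e_def by (simp add: algebra_simps)
  then have "e * D = 1 * D \<or> e * D = - 1 * D"
    using det det' unfolding D_def[symmetric] by auto
  moreover have "D \<noteq> 0" using det assms(2) by (auto simp: D_def)
  ultimately have "x * u - y * z = 1 \<or> x * u - y * z = -1"
    unfolding e_def[symmetric] mult_cancel_right by simp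
  then show ?thesis using that 1 2 by blast
qed

text \<open>\<open>A\<close> is the least nonzero norm, \<open>C\<close> the least norm off the line
  of the first vector; both are thus bounded by the entries of any other reduced basis.\<close>

lemma reduced_form_le:
  assumes "coprime (fst \<sigma> ^ 2 + snd \<sigma> ^ 2) n" "n > 0"
    and T: "(A, m, C) \<in> reduced_forms n" "(A', m', C') \<in> reduced_forms n"
    and bas: "lattice_bases n \<sigma> (A, m, C) \<noteq> {}" "lattice_bases n \<sigma> (A', m', C') \<noteq> {}"
  shows "A \<le> A' \<and> C \<le> C'"
proof -
  obtain p q r w p' q' r' w' where b: "(p, q, r, w) \<in> lattice_bases n \<sigma> (A, m, C)"
    "(p', q', r', w') \<in> lattice_bases n \<sigma> (A', m', C')" using bas by fast
  obtain x y z u where xy: "p' = x * p + y * r" "q' = x * q + y * w"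
    "r' = z * p + u * r" "w' = z * q + u * w" "x * u - y * z = 1 \<or> x * u - y * z = -1"
    using lattice_bases_related[OF assms(1,2) T b] .
  have "(p, q, r, w) \<in> gram_sols A m C" "(p', q', r', w') \<in> gram_sols A' m' C'"
    using b by (auto simp: lattice_bases_def)
  note * = gram_change_basis[OF this[unfolded xy(1-4)]]
  have red: "0 \<le> m" "2 * m \<le> A" "A \<le> C" "A' \<le> C'" using T by (auto simp: reduced_forms_def)
  have "x \<noteq> 0 \<or> y \<noteq> 0" using xy(5) by auto
  then have "A \<le> A'" unfolding *(1) by (rule reduced_form_ge_min[OF red(1-3)])
  moreover have "C \<le> C'"
  proof (cases "u = 0")
    case False
    then show ?thesis unfolding *(2) by (rule reduced_form_ge[OF red(1-3)])
  next
    \<comment> \<open>The second new vector is on that line, so the first is not, and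
      \<open>A'\<close> is at most \<open>C'\<close>.\<close>
    case True
    then have "y \<noteq> 0" using xy(5) by auto
    then have "C \<le> A'" unfolding *(1) by (rule reduced_form_ge[OF red(1-3)])
    then show ?thesis using red(4) by linarith
  qed
  ultimately show ?thesis by blast
qed

lemma reduced_form_unique:
  assumes "coprime (fst \<sigma> ^ 2 + snd \<sigma> ^ 2) n" "n > 0"
    and "T \<in> reduced_forms n" "T' \<in> reduced_forms n"
    and "lattice_bases n \<sigma> T \<noteq> {}" "lattice_bases n \<sigma> T' \<noteq> {}"
  shows "T = T'"
proof -
  obtain A m C where T: "T = (A, m, C)" by (cases T)
  obtain A' m' C' where T': "T' = (A', m', C')" by (cases T')
  have "A = A'" "C = C'"
    using reduced_form_le[of \<sigma> n A m C A' m' C'] reduced_form_le[of \<sigma> n A' m' C' A m C]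
      assms unfolding T T' by auto
  moreover have red: "0 \<le> m" "0 \<le> m'" "A * C - m\<^sup>2 = n\<^sup>2" "A' * C' - m'\<^sup>2 = n\<^sup>2"
    using assms(3,4) by (auto simp: T T' reduced_forms_def)
  have "m\<^sup>2 = m'\<^sup>2" using red(3,4) unfolding \<open>A = A'\<close> \<open>C = C'\<close> by linarith
  then have "m = m'" using red(1,2) by simp
  ultimately show ?thesis unfolding T T' by simp
qed

section \<open>Fibres over the reduced forms\<close>

text \<open>The boundary of the reduction domain. For \<open>n > 1\<close> exactly these reduced
  forms have an automorphism of determinant -1.\<close>

definition ambiguous_form :: "int \<times> int \<times> int \<Rightarrow> bool" where
  "ambiguous_form = (\<lambda>(A, m, C). m = 0 \<or> A = 2 * m \<or> A = C)"


text \<open>The boundary cases exclude each other: two at once would give the square form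
  \<open>(1, 0, 1)\<close> with \<open>n^2 = 1\<close> or the hexagonal form
  \<open>(2, 1, 2)\<close> with \<open>n^2 = 3\<close>.\<close>

lemma reduced_form_facts:
  assumes "(A, m, C) \<in> reduced_forms n" "n > 1"
  shows "A > 0" "m = 0 \<Longrightarrow> A \<noteq> C" "A = 2 * m \<Longrightarrow> A \<noteq> C"
proof -
  have red: "0 \<le> m" "2 * m \<le> A" "A \<le> C" "A * C - m\<^sup>2 = n\<^sup>2" "gcd A (gcd m C) = 1"
    using assms(1) by (auto simp: reduced_forms_def)
  have n2: "n\<^sup>2 > 1" using assms(2) by (simp add: one_less_power)
  show "A > 0"
  proof (rule ccontr)
    assume "\<not> A > 0"
    then have "A = 0" using red by linarith
    then have "n\<^sup>2 = - (m\<^sup>2)" using red(4) by simp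
    then show False using n2 zero_le_power2[of m] by linarith
  qed
  show "A \<noteq> C" if "m = 0"
  proof
    assume "A = C"
    then have "A = 1" using that red by simp
    then show False using \<open>A = C\<close> that red(4) n2 by simp
  qed
  show "A \<noteq> C" if "A = 2 * m"
  proof
    assume "A = C"
    then have "m dvd gcd A (gcd m C)" using that by auto
    then have "m = 1" using red by simp
    then have "n\<^sup>2 = 3" using red(4) that \<open>A = C\<close> by simp
    moreover have "n\<^sup>2 \<ge> 2\<^sup>2" using assms(2) by (intro power_mono) auto
    ultimately show False by simp
  qed
qed

text \<open>If the first vector stays on its line, it keeps its length up to sign and the value of
  \<open>m\<close> determines the second. If it leaves the line, minimality forces
  \<open>A = C\<close>, and only the exchange of the two vectors remains.\<close>

lemma reduced_form_automorphism:
  assumes red: "(A, m, C) \<in> reduced_forms n" and n: "n > 1"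
    and A: "A = A * x\<^sup>2 + 2 * m * x * y + C * y\<^sup>2"
    and C: "C = A * z\<^sup>2 + 2 * m * z * u + C * u\<^sup>2"
    and m: "m = A * x * z + m * (x * u + y * z) + C * y * u"
    and det: "x * u - y * z = 1 \<or> x * u - y * z = -1"
  obtains e where "e = 1 \<or> e = -1"
    "(x, y, z, u) = (e, 0, 0, e) \<or> m = 0 \<and> (x, y, z, u) = (e, 0, 0, - e) \<or>
     A = 2 * m \<and> (x, y, z, u) = (e, 0, e, - e) \<or> A = C \<and> (x, y, z, u) = (0, e, e, 0)"
proof -
  have r: "0 \<le> m" "2 * m \<le> A" "A \<le> C" using red by (auto simp: reduced_forms_def)
  note facts = reduced_form_facts[OF red n]
  show ?thesis
  proof (cases "y = 0")
    case y: True
    then have "A * x\<^sup>2 = A * 1" using A by simp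
    then have x: "x = 1 \<or> x = -1" using facts(1) by (simp add: power2_eq_1_iff)
    then have xx: "x * x = 1" by auto
    have u: "u = x \<or> u = - x" using det x y by auto
    then show ?thesis
    proof
      assume u: "u = x"
      then have "A * x * z = 0" using m y xx by simp
      then have "z = 0" using facts(1) x by auto
      then show ?thesis using that[of x] x u y by simp
    next
      assume u: "u = - x"
      then have "m = A * (x * z) - m * (x * x)" using m y by (simp add: algebra_simps)
      then have e: "A * (x * z) = 2 * m" using xx by simp
      then have "0 \<le> A * (x * z)" "A * (x * z) \<le> A * 1" using r by simp_all
      then have "0 \<le> x * z" "x * z \<le> 1"
        using facts(1) by (simp_all only: mult_le_cancel_left_pos) (simp add: zero_le_mult_iff)
      then have "x * z = 0 \<or> x * z = 1" by linarith
      then show ?thesis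
      proof
        assume "x * z = 0"
        then have "z = 0" "m = 0" using x e by auto
        then show ?thesis using that[of x] x u y by simp
      next
        assume "x * z = 1"
        then have "z = x" "A = 2 * m" using x e by auto
        then show ?thesis using that[of x] x u y by simp
      qed
    qed
  next
    case y: False
    have "C \<le> A" using reduced_form_ge[OF r y, of x] A by linarith
    then have AC: "A = C" using r by linarith
    then have "m \<noteq> 0" "A \<noteq> 2 * m" using facts(2,3) by auto
    then have strict: "2 * m < A" "0 < m" using r by linarith+
    \<comment> \<open>Strictness of \<open>2 * m < A\<close> leaves no vectors of norm
      \<open>A\<close> besides the basis vectors and their negatives.\<close>
    have off: "a = 0 \<or> b = 0" if eq: "A = A * a\<^sup>2 + 2 * m * a * b + A * b\<^sup>2" for a b :: int
    proof (rule ccontr)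
      assume ab: "\<not> ?thesis"
      define X Y where "X = \<bar>a\<bar>" and "Y = \<bar>b\<bar>"
      have XY: "X \<ge> 1" "Y \<ge> 1" using ab by (auto simp: X_def Y_def)
      then have XY1: "1 * 1 \<le> X * Y" by (intro mult_mono) auto
      then have "2 * m * (X * Y) < A * (X * Y)"
        using strict by (intro mult_strict_right_mono) auto
      moreover have "2 * m * (- (X * Y)) \<le> 2 * m * (a * b)"
        unfolding X_def Y_def abs_mult[symmetric] using strict by (intro mult_left_mono) auto
      ultimately have "A * X\<^sup>2 - A * (X * Y) + A * Y\<^sup>2 < A * 1"
        using eq by (simp add: X_def Y_def algebra_simps)
      then have "A * (X\<^sup>2 - X * Y + Y\<^sup>2) < A * 1" by (simp add: algebra_simps)
      then have "X\<^sup>2 - X * Y + Y\<^sup>2 < 1" using facts(1) by (simp only: mult_less_cancel_left_pos)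
      moreover have "0 \<le> (X - Y) * (X - Y)" by simp
      then have "0 \<le> X\<^sup>2 - 2 * (X * Y) + Y\<^sup>2" by (simp add: algebra_simps power2_eq_square)
      ultimately show False using XY1 by linarith
    qed
    have x: "x = 0" using off[of x y] A AC y by auto
    then have "u = 0" using off[of z u] C AC det by auto
    have "y * z = 1 \<or> y * z = -1" using det x by auto
    moreover have "m = m * (y * z)" using m x \<open>u = 0\<close> by simp
    ultimately have "y * z = 1" using strict by auto
    then have "y = 1 \<and> z = 1 \<or> y = -1 \<and> z = -1" by (simp add: zmult_eq_1_iff)
    then show ?thesis using that[of y] x \<open>u = 0\<close> AC by auto
  qed
qed

text \<open>All bases with the given Gram matrix are images of one of them under automorphisms. The
  nested conditional loses nothing because its cases exclude each other; the list form lets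
  distinctness give the cardinality.\<close>

lemma lattice_bases_eq:
  assumes cop: "coprime (fst \<sigma> ^ 2 + snd \<sigma> ^ 2) n" and n: "n > 1"
    and red: "(A, m, C) \<in> reduced_forms n"
    and b: "(p, q, r, w) \<in> lattice_bases n \<sigma> (A, m, C)"
  shows "lattice_bases n \<sigma> (A, m, C) = set ((p, q, r, w) # (-p, -q, -r, -w) #
    (if m = 0 then [(p, q, -r, -w), (-p, -q, r, w)]
     else if A = 2 * m then [(p, q, p - r, q - w), (-p, -q, r - p, w - q)]
     else if A = C then [(r, w, p, q), (-r, -w, -p, -q)] else []))" (is "?B = ?R")
proof
  have g: "p\<^sup>2 + q\<^sup>2 = A" "p * r + q * w = m" "r\<^sup>2 + w\<^sup>2 = C"
    and lat: "in_lattice n \<sigma> p q" "in_lattice n \<sigma> r w"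
    using b by (auto simp: lattice_bases_def gram_sols_def)
  have zero: "in_lattice n \<sigma> 0 0" by (cases \<sigma>) (simp add: in_lattice_def)
  have neg: "in_lattice n \<sigma> (- a) (- b)" if "in_lattice n \<sigma> a b" for a b
    using in_lattice_add_mult[OF zero that, of "-1"] by simp
  have diff: "in_lattice n \<sigma> (p - r) (q - w)" "in_lattice n \<sigma> (r - p) (w - q)"
    using in_lattice_add_mult[OF lat(1,2), of "-1"] in_lattice_add_mult[OF lat(2,1), of "-1"] by simp_all
  have "(p - r)\<^sup>2 + (q - w)\<^sup>2 = A - 2 * m + C" "p * (p - r) + q * (q - w) = A - m"
    unfolding g[symmetric] by (simp_all add: algebra_simps power2_eq_square)
  then have sol: "(p, q, p - r, q - w) \<in> gram_sols A m C" "(-p, -q, r - p, w - q) \<in> gram_sols A m C"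
    if "A = 2 * m" using that g
    by (simp_all add: gram_sols_def) (simp_all add: power2_commute algebra_simps)
  have sol2: "(p, q, -r, -w) \<in> gram_sols A m C" "(-p, -q, r, w) \<in> gram_sols A m C" if "m = 0"
    using that g by (simp_all add: gram_sols_def) 
  have sol3: "(r, w, p, q) \<in> gram_sols A m C" "(-r, -w, -p, -q) \<in> gram_sols A m C" if "A = C"
    using that g by (simp_all add: gram_sols_def algebra_simps)
  have sol4: "(p, q, r, w) \<in> gram_sols A m C" "(-p, -q, -r, -w) \<in> gram_sols A m C"
    using g by (simp_all add: gram_sols_def)
  show "?R \<subseteq> ?B"
    using sol sol2 sol3 sol4 lat neg diff by (auto simp: lattice_bases_def)
  show "?B \<subseteq> ?R"
  proof
    fix v assume v: "v \<in> ?B"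
    obtain p' q' r' w' where vv: "v = (p', q', r', w')" by (cases v)
    obtain x y z u where xy: "p' = x * p + y * r" "q' = x * q + y * w"
      "r' = z * p + u * r" "w' = z * q + u * w" "x * u - y * z = 1 \<or> x * u - y * z = -1"
      using lattice_bases_related[OF cop _ red red b v[unfolded vv]] n
      by (metis less_trans zero_less_one)
    have "(p, q, r, w) \<in> gram_sols A m C" "(p', q', r', w') \<in> gram_sols A m C"
      using b v by (auto simp: lattice_bases_def vv)
    note * = gram_change_basis[OF this[unfolded xy(1-4)]]
    obtain e where e: "e = 1 \<or> e = -1"
      "(x, y, z, u) = (e, 0, 0, e) \<or> m = 0 \<and> (x, y, z, u) = (e, 0, 0, - e) \<or>
       A = 2 * m \<and> (x, y, z, u) = (e, 0, e, - e) \<or> A = C \<and> (x, y, z, u) = (0, e, e, 0)"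
      using reduced_form_automorphism[OF red n * xy(5)] .
    moreover have "m \<noteq> 0" if "A = 2 * m" using reduced_form_facts(1)[OF red n] that by simp
    moreover have "A \<noteq> 2 * m" "m \<noteq> 0" if "A = C" using reduced_form_facts(2,3)[OF red n] that by auto
    ultimately show "v \<in> ?R" unfolding vv xy by (elim disjE) auto
  qed
qed

lemma card_lattice_bases:
  assumes cop: "coprime (fst \<sigma> ^ 2 + snd \<sigma> ^ 2) n" and n: "n > 1"
    and red: "T \<in> reduced_forms n" and ne: "lattice_bases n \<sigma> T \<noteq> {}"
  shows "card (lattice_bases n \<sigma> T) = (if ambiguous_form T then 4 else 2)"
proof -
  obtain A m C where T: "T = (A, m, C)" by (cases T)
  obtain p q r w where b: "(p, q, r, w) \<in> lattice_bases n \<sigma> (A, m, C)" using ne T by fast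
  then have sol: "(p, q, r, w) \<in> gram_sols A m C" by (auto simp: lattice_bases_def)
  have AC: "A * C - m\<^sup>2 = n\<^sup>2" using red by (auto simp: T reduced_forms_def)
  have det: "p * w - q * r \<noteq> 0" using gram_det[OF sol AC] n by auto
  have nz: "p \<noteq> 0 \<or> q \<noteq> 0" "r \<noteq> 0 \<or> w \<noteq> 0" using det by auto
  \<comment> \<open>A coincidence in the list would be a linear relation between the two
    vectors.\<close>
  have ne: "p \<noteq> r \<or> q \<noteq> w" "p \<noteq> - r \<or> q \<noteq> - w" "p \<noteq> 2 * r \<or> q \<noteq> 2 * w" using det by auto
  have "distinct ((p, q, r, w) # (-p, -q, -r, -w) #
    (if m = 0 then [(p, q, -r, -w), (-p, -q, r, w)]
     else if A = 2 * m then [(p, q, p - r, q - w), (-p, -q, r - p, w - q)]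
     else if A = C then [(r, w, p, q), (-r, -w, -p, -q)] else []))"
    using nz ne by auto
  then show ?thesis
    unfolding T lattice_bases_eq[OF cop n red[unfolded T] b]
    by (subst distinct_card) (simp_all add: ambiguous_form_def)
qed

definition fiber :: "int \<Rightarrow> int \<times> int \<times> int \<Rightarrow> (int \<times> int) set" where
  "fiber n T = {\<sigma> \<in> unit_points n. lattice_bases n \<sigma> T \<noteq> {}}"

lemma finite_unit_points: "finite (unit_points n)"
  by (rule finite_subset[of _ "{0..<n} \<times> {0..<n}"]) (auto simp: unit_points_def)

text \<open>Double counting of pairs of a point and a basis: each of the eight realisations belongs
  to \<open>totient n\<close> points, and each point of the fibre has four or two bases.\<close>

lemma card_fiber:
  fixes n :: nat
  assumes "n > 1" "T \<in> reduced_forms (int n)"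
  shows "card (fiber (int n) T) = (if ambiguous_form T then 2 else 4) * totient n"
proof -
  obtain A m C where T: "T = (A, m, C)" by (cases T)
  have red: "0 \<le> A" "0 \<le> C" "A * C - m\<^sup>2 = (int n)\<^sup>2" "gcd A (gcd m C) = 1"
    using assms(2) by (auto simp: T reduced_forms_def)
  have G8: "card (gram_sols A m C) = 8" using card_gram_sols[OF red(1-3) _ red(4)] assms(1) by simp
  then have finG: "finite (gram_sols A m C)" by (metis card.infinite zero_neq_numeral)
  let ?L = "\<lambda>\<sigma>. lattice_bases (int n) \<sigma> T"
  let ?P = "\<lambda>b. {\<sigma> \<in> unit_points (int n). b \<in> ?L \<sigma>}"
  have LG: "?L \<sigma> \<subseteq> gram_sols A m C" for \<sigma> by (auto simp: lattice_bases_def T)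
  have LL: "{b \<in> gram_sols A m C. b \<in> ?L \<sigma>} = ?L \<sigma>" for \<sigma> using LG by blast
  have "(\<Sum>\<sigma> \<in> unit_points (int n). card {b \<in> gram_sols A m C. b \<in> ?L \<sigma>}) =
      totient n * card (gram_sols A m C)"
  proof (rule sum_multicount)
    show "\<forall>b\<in>gram_sols A m C. card (?P b) = totient n"
    proof
      fix b assume b: "b \<in> gram_sols A m C"
      obtain p q r s where bb: "b = (p, q, r, s)" by (cases b)
      show "card (?P b) = totient n"
        using card_points_of_lattice[OF assms(1) b[unfolded bb] red(3,4)] b
        by (simp add: lattice_bases_def T bb)
    qed
  qed (use finG finite_unit_points in auto)
  then have "totient n * card (gram_sols A m C) = (\<Sum>\<sigma> \<in> unit_points (int n). card (?L \<sigma>))"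
    unfolding LL by simp
  also have "\<dots> = (\<Sum>\<sigma> \<in> fiber (int n) T. card (?L \<sigma>))"
    by (rule sum.mono_neutral_right) (auto simp: finite_unit_points fiber_def)
  also have "\<dots> = (\<Sum>\<sigma> \<in> fiber (int n) T. if ambiguous_form T then 4 else 2)"
    by (rule sum.cong[OF refl], rule card_lattice_bases)
       (use assms in \<open>auto simp: fiber_def unit_points_def\<close>)
  finally show ?thesis using G8 by (simp split: if_splits)
qed

lemma unit_points_eq_Union:
  assumes "n > 1"
  shows "unit_points n = (\<Union>T\<in>reduced_forms n. fiber n T)"
proof
  show "unit_points n \<subseteq> (\<Union>T\<in>reduced_forms n. fiber n T)"
  proof
    fix \<sigma> assume \<sigma>: "\<sigma> \<in> unit_points n"
    obtain s t where st: "\<sigma> = (s, t)" by (cases \<sigma>)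
    have "coprime (s\<^sup>2 + t\<^sup>2) n" using \<sigma> by (simp add: unit_points_def st)
    then obtain T where "T \<in> reduced_forms n" "lattice_bases n (s, t) T \<noteq> {}"
      using lattice_has_reduced_basis assms by metis
    then show "\<sigma> \<in> (\<Union>T\<in>reduced_forms n. fiber n T)" using \<sigma> st by (auto simp: fiber_def)
  qed
qed (auto simp: fiber_def)

lemma finite_reduced_forms:
  assumes "n \<noteq> 0"
  shows "finite (reduced_forms n)"
proof (rule finite_subset)
  show "reduced_forms n \<subseteq> {0..2 * n\<^sup>2} \<times> {0..2 * n\<^sup>2} \<times> {0..2 * n\<^sup>2}"
  proof
    fix T assume T_in: "T \<in> reduced_forms n"
    obtain A m C where T: "T = (A, m, C)" by (cases T)
    have r: "0 \<le> m" "2 * m \<le> A" "A \<le> C" "A * C - m\<^sup>2 = n\<^sup>2" "gcd A (gcd m C) = 1"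
      using T_in by (auto simp: reduced_forms_def T)
    \<comment> \<open>As \<open>4 * m^2\<close> is at most \<open>A * C\<close>, the determinant
      equation gives \<open>3 * A * C <= 4 * n^2\<close>; the cruder bound \<open>2 * n^2\<close>
      suffices.\<close>
    have "2 * m * (2 * m) \<le> A * C" using r by (intro mult_mono) auto
    then have 1: "A * C \<le> 2 * n\<^sup>2" using r(4) zero_le_square[of m] zero_le_square[of n]
      unfolding power2_eq_square by linarith
    have "C \<le> 2 * n\<^sup>2"
    proof (cases "A = 0")
      case True
      then show ?thesis using r assms by auto
    next
      case False
      then have "1 * C \<le> A * C" using r by (intro mult_right_mono) auto
      then show ?thesis using 1 by simp
    qed
    then show "T \<in> {0..2 * n\<^sup>2} \<times> {0..2 * n\<^sup>2} \<times> {0..2 * n\<^sup>2}" using r T by auto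
  qed
qed simp

text \<open>The fibres partition the points. The shortfall of \<open>2 * totient n\<close> at each
  ambiguous form stands on the left to avoid subtraction.\<close>

lemma card_unit_points_eq:
  fixes n :: nat
  assumes "n > 1"
  shows "card (unit_points (int n)) + 2 * totient n * card {T \<in> reduced_forms (int n). ambiguous_form T} =
    4 * totient n * card (reduced_forms (int n))"
proof -
  let ?R = "reduced_forms (int n)"
  have n: "int n > 1" "int n > 0" using assms by auto
  have fin: "finite ?R" using finite_reduced_forms n(2) by simp
  have "card (unit_points (int n)) = (\<Sum>T\<in>?R. card (fiber (int n) T))"
    unfolding unit_points_eq_Union[OF n(1)]
  proof (rule card_UN_disjoint[OF fin])
    show "\<forall>T\<in>?R. finite (fiber (int n) T)"
      by (auto simp: fiber_def finite_unit_points)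
    show "\<forall>T\<in>?R. \<forall>T'\<in>?R. T \<noteq> T' \<longrightarrow> fiber (int n) T \<inter> fiber (int n) T' = {}"
      using reduced_form_unique[OF _ n(2)] by (fastforce simp: fiber_def unit_points_def)
  qed
  also have "\<dots> = (\<Sum>T\<in>?R. (if ambiguous_form T then 2 else 4) * totient n)"
    by (rule sum.cong) (use card_fiber[OF assms] in auto)
  finally have "card (unit_points (int n)) + (\<Sum>T\<in>?R. (if ambiguous_form T then 2 * totient n else 0)) =
    (\<Sum>T\<in>?R. 4 * totient n)"
    by (simp only: sum.distrib[symmetric]) (intro sum.cong, auto)
  then show ?thesis using fin by (simp add: sum.If_cases Int_def algebra_simps)
qed

section \<open>Counting the points\<close>

lemma coprime_sum_squares_mod:
  fixes s t a n :: int
  assumes "n dvd a"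
  shows "coprime ((s mod a)\<^sup>2 + (t mod a)\<^sup>2) n \<longleftrightarrow> coprime (s\<^sup>2 + t\<^sup>2) n"
proof -
  have "[s mod a = s] (mod n)" "[t mod a = t] (mod n)"
    using assms by (meson cong_mod_left cong_refl cong_dvd_modulus)+
  then have "[(s mod a)\<^sup>2 + (t mod a)\<^sup>2 = s\<^sup>2 + t\<^sup>2] (mod n)"
    by (intro cong_add cong_pow)
  then show ?thesis by (metis cong_imp_coprime cong_sym)
qed

text \<open>The Chinese remainder theorem in both coordinates.\<close>

lemma card_unit_points_mult:
  assumes "a > 0" "b > 0" "coprime a b"
  shows "card (unit_points (a * b)) = card (unit_points a) * card (unit_points b)"
proof -
  let ?f = "\<lambda>(s, t). ((s mod a, t mod a), (s mod b, t mod b))"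
  have ab: "a * b > 0" using assms by simp
  have "bij_betw ?f (unit_points (a * b)) (unit_points a \<times> unit_points b)"
  proof (rule bij_betw_imageI)
    show "inj_on ?f (unit_points (a * b))"
    proof (rule inj_onI, clarify)
      fix s t s' t' assume *: "(s, t) \<in> unit_points (a * b)" "(s', t') \<in> unit_points (a * b)"
        "s mod a = s' mod a" "t mod a = t' mod a" "s mod b = s' mod b" "t mod b = t' mod b"
      then have "[s = s'] (mod a * b)" "[t = t'] (mod a * b)"
        using assms(3) by (simp_all add: coprime_cong_mult cong_def[of _ _ a] cong_def[of _ _ b])
      then show "s = s' \<and> t = t'" using *(1,2) by (auto simp: unit_points_def cong_def)
    qed
    show "?f ` unit_points (a * b) = unit_points a \<times> unit_points b"
    proof
      show "?f ` unit_points (a * b) \<subseteq> unit_points a \<times> unit_points b"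
        using assms by (auto simp: unit_points_def coprime_sum_squares_mod)
      show "unit_points a \<times> unit_points b \<subseteq> ?f ` unit_points (a * b)"
      proof clarify
        fix s t s' t' assume *: "(s, t) \<in> unit_points a" "(s', t') \<in> unit_points b"
        obtain x where x: "[x = s] (mod a)" "[x = s'] (mod b)"
          using binary_chinese_remainder_int[OF assms(3)] by blast
        obtain y where y: "[y = t] (mod a)" "[y = t'] (mod b)"
          using binary_chinese_remainder_int[OF assms(3)] by blast
        have eq: "x mod a = s" "y mod a = t" "x mod b = s'" "y mod b = t'"
          using x y * by (auto simp: cong_def unit_points_def)
        have "coprime (x\<^sup>2 + y\<^sup>2) a" "coprime (x\<^sup>2 + y\<^sup>2) b"
          using * coprime_sum_squares_mod[of a a x y] coprime_sum_squares_mod[of b b x y]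
          by (auto simp: eq unit_points_def)
        then have "(x mod (a * b), y mod (a * b)) \<in> unit_points (a * b)"
          using ab coprime_sum_squares_mod[of "a * b" "a * b" x y] by (simp add: unit_points_def)
        moreover have "((s, t), (s', t')) = ?f (x mod (a * b), y mod (a * b))"
          by (simp add: mod_mod_cancel eq)
        ultimately show "((s, t), (s', t')) \<in> ?f ` unit_points (a * b)" by (rule rev_image_eqI)
      qed
    qed
  qed
  then show ?thesis by (simp add: bij_betw_same_card card_cartesian_product)
qed

text \<open>The condition depends only on the residues modulo \<open>p\<close>; the two quotients by
  \<open>p\<close> range freely over \<open>p ^ k\<close> values each.\<close>

lemma card_unit_points_prime_power:
  fixes p :: int
  assumes "p > 0"
  shows "card (unit_points (p ^ Suc k)) = nat p ^ (2 * k) * card (unit_points p)"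
proof -
  let ?f = "\<lambda>(s, t). ((s mod p, t mod p), (s div p, t div p))"
  let ?g = "\<lambda>((s, t), (i, j)). (p * i + s, p * j + t)"
  let ?I = "{0..<p ^ k} \<times> {0..<p ^ k}"
  have div: "x div p < p ^ k" if "x < p * p ^ k" for x
  proof (rule ccontr)
    assume "\<not> x div p < p ^ k"
    then have "p * p ^ k \<le> p * (x div p)" using assms by (intro mult_left_mono) auto
    also have "\<dots> \<le> x" using assms mult_div_mod_eq[of p x] pos_mod_sign[of p x] by linarith
    finally show False using that by simp
  qed
  have lt: "p * i + x < p * p ^ k" if "i < p ^ k" "x < p" for i x
  proof -
    have "p * (i + 1) \<le> p * p ^ k" using that assms by (intro mult_left_mono) auto
    then show ?thesis using that by (simp add: algebra_simps)
  qed
  have cop: "coprime x (p * p ^ k) \<longleftrightarrow> coprime x p" for x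
    by (cases k) auto
  have "bij_betw ?f (unit_points (p ^ Suc k)) (unit_points p \<times> ?I)"
  proof (rule bij_betw_byWitness[where f' = ?g])
    show "?f ` unit_points (p ^ Suc k) \<subseteq> unit_points p \<times> ?I"
      using assms div by (auto simp: unit_points_def coprime_sum_squares_mod cop pos_imp_zdiv_nonneg_iff)
    show "?g ` (unit_points p \<times> ?I) \<subseteq> unit_points (p ^ Suc k)"
    proof clarify
      fix s t i j assume *: "(s, t) \<in> unit_points p" "i \<in> {0..<p ^ k}" "j \<in> {0..<p ^ k}"
      then have "coprime ((p * i + s)\<^sup>2 + (p * j + t)\<^sup>2) p"
        using coprime_sum_squares_mod[of p p "p * i + s" "p * j + t"] by (auto simp: unit_points_def)
      then show "(p * i + s, p * j + t) \<in> unit_points (p ^ Suc k)"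
        using * lt assms by (auto simp: unit_points_def cop)
    qed
  qed (use assms in \<open>auto simp: unit_points_def\<close>)
  then have "card (unit_points (p ^ Suc k)) = card (unit_points p \<times> ?I)"
    by (rule bij_betw_same_card)
  also have "\<dots> = card (unit_points p) * (nat p ^ k * nat p ^ k)"
    using assms by (simp only: card_cartesian_product card_atLeastLessThan_int)
      (simp add: nat_power_eq)
  finally show ?thesis by (simp add: mult_2 power_add)
qed

lemma coprime_prime_iff:
  fixes p x :: "'a :: factorial_semiring_gcd"
  assumes "prime p"
  shows "coprime p x \<longleftrightarrow> \<not> p dvd x"
proof
  show "\<not> p dvd x" if "coprime p x"
    using that assms not_coprimeI[of p p x] by (auto dest: not_prime_unit)
  show "coprime p x" if "\<not> p dvd x"
    using that assms by (intro prime_imp_coprime)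
qed

lemma chi_m4_QuadRes:
  assumes "prime p" "p > 2"
  shows "chi_m4 p = (if QuadRes (int p) (- 1) then 1 else - 1)"
proof -
  have odd: "odd p" using assms prime_odd_nat by simp
  have "[Legendre (- 1) (int p) = chi_m4 p] (mod int p)"
    using euler_criterion[OF assms, of "- 1"] odd by (simp add: chi_m4_def)
  then have d: "int p dvd Legendre (- 1) (int p) - chi_m4 p" by (simp add: cong_iff_dvd_diff)
  have "\<not> [- 1 = 0] (mod int p)" using assms(2) by (simp add: cong_iff_dvd_diff)
  then have L: "Legendre (- 1) (int p) = (if QuadRes (int p) (- 1) then 1 else - 1)"
    by (simp add: Legendre_def)
  have "chi_m4 p = 1 \<or> chi_m4 p = - 1"
    using odd by (auto simp: chi_m4_def minus_one_power_iff)
  \<comment> \<open>Two signs differ by at most 2, so for \<open>p > 2\<close> congruence means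
    equality.\<close>
  then have "\<bar>Legendre (- 1) (int p) - chi_m4 p\<bar> < int p" using L assms(2) by auto
  then have "Legendre (- 1) (int p) - chi_m4 p = 0" using d by (metis dvd_imp_le_int not_less abs_of_nat)
  then show ?thesis using L by simp
qed

text \<open>If \<open>i\<close> is a square root of -1 modulo \<open>p\<close>, the sum of squares
  factors as \<open>(t - i * s) * (t + i * s)\<close> and the zeros are two lines through the
  origin, with \<open>2 * p - 1\<close> points. Otherwise the origin is the only zero.\<close>

lemma card_sum_squares_zeros:
  assumes "prime p" "p > 2"
  shows "int (card {(s, t). s \<in> {0..<int p} \<and> t \<in> {0..<int p} \<and> int p dvd s\<^sup>2 + t\<^sup>2}) =
    1 + (int p - 1) * (1 + chi_m4 p)" (is "int (card ?Z) = _")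
proof (cases "QuadRes (int p) (- 1)")
  case True
  define P where "P = int p"
  have P: "prime P" "P > 2" using assms by (simp_all add: P_def)
  obtain i where "[i\<^sup>2 = - 1] (mod P)" using True by (auto simp: QuadRes_def P_def)
  then have i: "P dvd i\<^sup>2 + 1" by (simp add: cong_iff_dvd_diff)
  let ?Z1 = "(\<lambda>s. (s, (i * s) mod P)) ` {0..<P}"
  let ?Z2 = "(\<lambda>s. (s, (- i * s) mod P)) ` {0..<P}"
  have ni: "\<not> P dvd i"
  proof
    assume "P dvd i"
    then have "P dvd i\<^sup>2" by (simp add: power2_eq_square)
    then have "P dvd 1" using i by (simp add: dvd_add_right_iff)
    then show False using P by simp
  qed
  have "z \<in> ?Z \<longleftrightarrow> z \<in> ?Z1 \<union> ?Z2" for z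
  proof -
    obtain s t where z: "z = (s, t)" by (cases z)
    have "s\<^sup>2 + t\<^sup>2 = (t - i * s) * (t + i * s) + s\<^sup>2 * (i\<^sup>2 + 1)"
      by (simp add: algebra_simps power2_eq_square)
    then have "P dvd s\<^sup>2 + t\<^sup>2 \<longleftrightarrow> P dvd (t - i * s) * (t + i * s)"
      using i by (simp add: dvd_add_left_iff)
    also have "\<dots> \<longleftrightarrow> P dvd t - i * s \<or> P dvd t - (- i * s)"
      using P(1) by (simp add: prime_dvd_mult_iff)
    also have "\<dots> \<longleftrightarrow> t mod P = (i * s) mod P \<or> t mod P = (- i * s) mod P"
      by (simp only: mod_eq_dvd_iff)
    finally have "P dvd s\<^sup>2 + t\<^sup>2 \<longleftrightarrow> t mod P = (i * s) mod P \<or> t mod P = (- i * s) mod P" .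
    then show ?thesis
      using P(2) unfolding P_def[symmetric] z by auto
  qed
  then have "?Z = ?Z1 \<union> ?Z2" by blast
  moreover have "?Z1 \<inter> ?Z2 = {(0, 0)}"
  proof
    show "?Z1 \<inter> ?Z2 \<subseteq> {(0, 0)}"
    proof clarify
      fix s assume s: "s \<in> {0..<P}" and eq: "(i * s) mod P = (- i * s) mod P"
      have "P dvd i * s - (- i * s)" using eq by (simp only: mod_eq_dvd_iff)
      then have "P dvd 2 * i * s" by (simp add: mult.assoc)
      moreover have "\<not> P dvd 2" using P(2) zdvd_imp_le[of P 2] by auto
      ultimately have "P dvd s" using P(1) ni by (simp add: prime_dvd_mult_iff)
      then have "s = 0" using s by (metis atLeastLessThan_iff mod_pos_pos_trivial dvd_eq_mod_eq_0)
      then show "s = 0 \<and> i * s mod P = 0" by simp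
    qed
    show "{(0, 0)} \<subseteq> ?Z1 \<inter> ?Z2" using P(2) by (auto intro!: image_eqI[of _ _ 0])
  qed
  moreover have "card ?Z1 = p" "card ?Z2 = p"
    by (subst card_image; auto simp: inj_on_def P_def)+
  ultimately have "card ?Z + 1 = p + p"
    using card_Un_Int[of ?Z1 ?Z2] by simp
  then show ?thesis using True chi_m4_QuadRes[OF assms] by simp
next
  case False
  define P where "P = int p"
  have P: "prime P" "P > 2" using assms by (simp_all add: P_def)
  have "s = 0 \<and> t = 0" if "s \<in> {0..<P}" "t \<in> {0..<P}" "P dvd s\<^sup>2 + t\<^sup>2" for s t
  proof -
    \<comment> \<open>Otherwise \<open>s\<close> is invertible modulo \<open>P\<close>, and
      \<open>t / s\<close> would be a square root of -1.\<close>
    have "P dvd s"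
    proof (rule ccontr)
      assume "\<not> P dvd s"
      then have "coprime s P" using P(1) by (simp add: prime_imp_coprime coprime_commute)
      then obtain j where j: "[s * j = 1] (mod P)" using cong_solve_coprime_int by blast
      have "P dvd (s\<^sup>2 + t\<^sup>2) * j\<^sup>2" using that(3) by simp
      then have "[(s * j)\<^sup>2 + (t * j)\<^sup>2 = 0] (mod P)"
        by (simp add: cong_0_iff algebra_simps power_mult_distrib)
      moreover have "[(s * j)\<^sup>2 + (t * j)\<^sup>2 = 1\<^sup>2 + (t * j)\<^sup>2] (mod P)"
        by (intro cong_add cong_pow j cong_refl)
      ultimately have "[1 + (t * j)\<^sup>2 = 0] (mod P)" by (metis cong_sym cong_trans one_power2)
      then have "[(t * j)\<^sup>2 = - 1] (mod P)" by (simp add: cong_iff_dvd_diff add.commute)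
      then show False using False by (auto simp: QuadRes_def P_def)
    qed
    then have "P dvd s\<^sup>2" by (simp add: power2_eq_square)
    then have "P dvd t\<^sup>2" using that(3) by (simp add: dvd_add_right_iff)
    then have "P dvd t" using P(1) prime_dvd_power by blast
    with \<open>P dvd s\<close> show ?thesis
      using that(1,2) by (metis atLeastLessThan_iff mod_pos_pos_trivial dvd_eq_mod_eq_0)
  qed
  then have "?Z = {(0, 0)}" using P(2) unfolding P_def[symmetric] by auto
  then show ?thesis using False chi_m4_QuadRes[OF assms] by simp
qed

text \<open>For odd \<open>p\<close> the unit points are the complement of the zeros counted above;
  \<open>p = 2\<close> is checked directly.\<close>

lemma card_unit_points_prime:
  assumes "prime p"
  shows "int (card (unit_points (int p))) = (int p - 1) * (int p - chi_m4 p)"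
proof (cases "p = 2")
  case True
  have "unit_points 2 = {(0, 1), (1, 0)}"
  proof -
    have "{0..<2 :: int} = {0, 1}" by auto
    then show ?thesis by (auto simp: unit_points_def)
  qed
  then show ?thesis using True by (simp add: chi_m4_def)
next
  case False
  then have p2: "p > 2" using prime_ge_2_nat[OF assms] by simp
  let ?I = "{0..<int p} \<times> {0..<int p}"
  let ?Z = "{(s, t). s \<in> {0..<int p} \<and> t \<in> {0..<int p} \<and> int p dvd s\<^sup>2 + t\<^sup>2}"
  have cop: "coprime x (int p) \<longleftrightarrow> \<not> int p dvd x" for x
    using assms by (subst coprime_commute) (simp add: coprime_prime_iff)
  have "unit_points (int p) = ?I - ?Z" unfolding unit_points_def cop by auto
  moreover have sub: "?Z \<subseteq> ?I" by auto
  moreover have "finite ?Z" using sub by (rule finite_subset) simp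
  ultimately have "card (unit_points (int p)) = card ?I - card ?Z"
    by (simp only: card_Diff_subset)
  moreover have "card ?Z \<le> card ?I" using sub by (intro card_mono) simp_all
  ultimately have "int (card (unit_points (int p))) = int p * int p - int (card ?Z)"
    by (simp add: card_cartesian_product of_nat_diff)
  then show ?thesis unfolding card_sum_squares_zeros[OF assms p2] by (simp add: algebra_simps)
qed

text \<open>Induction for multiplicative functions: the full power of one prime is split off at each
  step.\<close>

lemma prime_power_mult_induct [consumes 1, case_names one mult]:
  fixes n :: nat
  assumes "n > 0" and one: "P 1"
    and mult: "\<And>p k m. prime p \<Longrightarrow> \<not> p dvd m \<Longrightarrow> m > 0 \<Longrightarrow> P m \<Longrightarrow> P (p ^ Suc k * m)"
  shows "P n"
  using assms(1)
proof (induction n rule: less_induct)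
  case (less n)
  show ?case
  proof (cases "n = 1")
    case True
    then show ?thesis using one by simp
  next
    case False
    then obtain p where p: "prime p" "p dvd n" using prime_factor_nat by blast
    obtain m where m: "n = p ^ multiplicity p n * m" "\<not> p dvd m"
      using multiplicity_decompose'[of n p] less.prems p(1) by (metis not_prime_unit less_irrefl)
    obtain k where k: "multiplicity p n = Suc k"
      using m p(2) by (cases "multiplicity p n") auto
    have n: "n = p ^ Suc k * m" using m(1) unfolding k .
    have "m > 0" using n less.prems by (cases m) auto
    moreover have "p ^ Suc k > 1"
      using one_less_power[OF prime_gt_1_nat[OF p(1)], of "Suc k"] by blast
    then have "m < n" using \<open>m > 0\<close> unfolding n by simp
    then have "P m" using less.IH \<open>m > 0\<close> by blast
    ultimately show ?thesis using mult[OF p(1) m(2)] n by metis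
  qed
qed

lemma prime_divisors_prime_power_mult:
  fixes p m :: nat
  assumes "prime p"
  shows "{r. prime r \<and> r dvd p ^ Suc k * m} = insert p {r. prime r \<and> r dvd m}"
proof -
  have "r dvd p ^ Suc k * m \<longleftrightarrow> r = p \<or> r dvd m" if "prime r" for r
    using that assms by (metis dvd_mult dvd_mult2 dvd_triv_left power_Suc prime_dvd_mult_iff
      prime_dvd_power primes_dvd_imp_eq)
  then show ?thesis using assms by blast
qed

lemma finite_prime_divisors: "m > 0 \<Longrightarrow> finite {r :: nat. prime r \<and> r dvd m}"
  by (rule finite_subset[of _ "{..m}"]) (auto dest: dvd_imp_le)

text \<open>Both sides are multiplicative. At \<open>q = p ^ Suc k\<close> the count
  \<open>p ^ (2 * k) * (p - 1) * (p - chi_m4 p)\<close> equals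
  \<open>q * totient q * (1 - chi_m4 p / p)\<close>.\<close>

lemma card_unit_points:
  fixes n :: nat
  assumes "n > 0"
  shows "real (card (unit_points (int n))) =
    real n * real (totient n) * (\<Prod>p | prime p \<and> p dvd n. 1 - real_of_int (chi_m4 p) / real p)"
  using assms
proof (induction rule: prime_power_mult_induct)
  case one
  have "unit_points 1 = {(0, 0)}" by (auto simp: unit_points_def)
  moreover have no: "{p :: nat. prime p \<and> p dvd 1} = {}" by (auto dest: prime_gt_1_nat)
  ultimately show ?case unfolding no by simp
next
  case (mult p k m)
  define q where "q = p ^ Suc k"
  have p0: "p > 1" using mult(1) prime_gt_1_nat by blast
  have cop: "coprime q m" unfolding q_def using mult(1,2) by (simp add: prime_imp_coprime)
  have "real (card (unit_points (int q))) = real p ^ (2 * k) * real_of_int (int (card (unit_points (int p))))"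
    using card_unit_points_prime_power[of "int p" k] p0 by (simp add: q_def)
  also have "\<dots> = real p ^ (2 * k) * ((real p - 1) * (real p - chi_m4 p))"
    unfolding card_unit_points_prime[OF mult(1)] by simp
  also have "\<dots> = real q * real (totient q) * (1 - chi_m4 p / real p)"
    unfolding q_def totient_prime_power_Suc[OF mult(1)] using p0
    by (simp only: mult_2 power_add) (simp add: field_simps of_nat_diff)
  finally have Q: "real (card (unit_points (int q))) = real q * real (totient q) * (1 - chi_m4 p / real p)" .
  have "card (unit_points (int (q * m))) = card (unit_points (int q)) * card (unit_points (int m))"
    unfolding of_nat_mult using cop mult(3) p0
    by (intro card_unit_points_mult) (auto simp: q_def)
  then show ?case
    unfolding q_def[symmetric] prime_divisors_prime_power_mult[OF mult(1), of k m, folded q_def]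
    using finite_prime_divisors[OF mult(3)] mult(2,4) Q totient_mult_coprime[OF cop] by simp
qed

section \<open>Factorizations into coprime factors\<close>

text \<open>The first components are the unitary divisors of \<open>N\<close>.\<close>

definition coprime_factorizations :: "nat \<Rightarrow> (nat \<times> nat) set" where
  "coprime_factorizations N = {(u, v). u * v = N \<and> coprime u v}"

text \<open>Each prime power goes wholly to one of the two factors. Finiteness is carried along
  because the cardinality of the union in the induction step uses it.\<close>

lemma card_coprime_factorizations:
  assumes "N > 0"
  shows "card (coprime_factorizations N) = 2 ^ omega N \<and> finite (coprime_factorizations N)"
  using assms
proof (induction rule: prime_power_mult_induct)
  case one
  have "coprime_factorizations 1 = {(1, 1)}" by (auto simp: coprime_factorizations_def)
  moreover have no: "{p :: nat. prime p \<and> p dvd 1} = {}" by (auto dest: prime_gt_1_nat)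
  ultimately show ?case unfolding omega_def no by simp
next
  case (mult p k m)
  define q where "q = p ^ Suc k"
  have q0: "q > 0" using mult(1) prime_gt_0_nat by (simp add: q_def)
  have cop: "coprime q x \<longleftrightarrow> \<not> p dvd x" for x
    using mult(1) by (simp add: q_def coprime_prime_iff del: power_Suc)
  let ?f = "\<lambda>(u, v). (q * u, v)" and ?g = "\<lambda>(u, v). (u, q * v)"
  let ?F = "coprime_factorizations m"
  have "coprime_factorizations (q * m) = ?f ` ?F \<union> ?g ` ?F"
  proof
    show "coprime_factorizations (q * m) \<subseteq> ?f ` ?F \<union> ?g ` ?F"
    proof clarify
      fix u v assume *: "(u, v) \<in> coprime_factorizations (q * m)" "(u, v) \<notin> ?g ` ?F"
      then have uv: "u * v = q * m" "coprime u v" by (auto simp: coprime_factorizations_def)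
      have "\<not> (p dvd u \<and> p dvd v)"
        using uv(2) mult(1) by (metis coprime_common_divisor_nat nat_dvd_1_iff_1 not_prime_unit)
      then consider "coprime q v" | "coprime q u" using cop by blast
      then show "(u, v) \<in> ?f ` ?F"
      proof cases
        case 1
        then have "q dvd u" using uv(1) by (metis coprime_dvd_mult_left_iff dvd_triv_left)
        then obtain w where w: "u = q * w" by auto
        then have "(w, v) \<in> ?F" using uv q0 by (auto simp: coprime_factorizations_def)
        then show ?thesis using w by force
      next
        case 2
        then have "q dvd v" using uv(1) by (metis coprime_dvd_mult_right_iff dvd_triv_left)
        then obtain w where w: "v = q * w" by auto
        then have "(u, w) \<in> ?F" using uv q0 by (auto simp: coprime_factorizations_def)
        then show ?thesis using w *(2) by force
      qed
    qed
    have "(q * u, v) \<in> coprime_factorizations (q * m)" "(u, q * v) \<in> coprime_factorizations (q * m)"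
      if uv: "(u, v) \<in> ?F" for u v
    proof -
      have "\<not> p dvd u" "\<not> p dvd v" using uv mult(2) by (auto simp: coprime_factorizations_def)
      then have "coprime q u" "coprime q v" by (simp_all add: cop)
      then show "(q * u, v) \<in> coprime_factorizations (q * m)" "(u, q * v) \<in> coprime_factorizations (q * m)"
        using uv by (simp_all add: coprime_factorizations_def coprime_commute)
    qed
    then show "?f ` ?F \<union> ?g ` ?F \<subseteq> coprime_factorizations (q * m)" by auto
  qed
  moreover have "?f ` ?F \<inter> ?g ` ?F = {}"
    using mult(1,2) by (auto simp: coprime_factorizations_def q_def)
  moreover have "card (?f ` ?F) = card ?F" "card (?g ` ?F) = card ?F"
    using q0 by (auto intro!: card_image simp: inj_on_def)
  ultimately have "card (coprime_factorizations (q * m)) = 2 * card ?F" "finite (coprime_factorizations (q * m))"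
    using mult(4) by (simp_all add: card_Un_disjoint)
  moreover have "omega (q * m) = Suc (omega m)"
    unfolding omega_def q_def prime_divisors_prime_power_mult[OF mult(1)]
    using finite_prime_divisors[OF mult(3)] mult(2) by simp
  ultimately show ?case using mult(4) by (simp add: q_def)
qed

definition ordered_factorizations :: "int \<Rightarrow> (int \<times> int) set" where
  "ordered_factorizations N = {(u, v). 0 < u \<and> u < v \<and> u * v = N \<and> coprime u v}"

text \<open>Coprime factors of \<open>N > 1\<close> are never equal, so exchanging them pairs off
  the coprime factorizations.\<close>

lemma card_ordered_factorizations:
  fixes N :: nat
  assumes "N > 1"
  shows "2 * card (ordered_factorizations (int N)) = 2 ^ omega N"
proof -
  let ?O = "ordered_factorizations (int N)"
  let ?f = "\<lambda>(u, v). (nat u, nat v)" and ?g = "\<lambda>(u, v). (nat v, nat u)"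
  have cop: "coprime (nat u) (nat v)" "nat u * nat v = N" if "coprime u v" "u * v = int N" "0 < u" "u < v" for u v
    using that by (metis coprime_int_iff int_nat_eq less_imp_le order_less_trans)
      (use that in \<open>simp add: nat_mult_distrib[symmetric]\<close>)
  have "coprime_factorizations N = ?f ` ?O \<union> ?g ` ?O"
  proof
    show "coprime_factorizations N \<subseteq> ?f ` ?O \<union> ?g ` ?O"
    proof clarify
      fix u v assume *: "(u, v) \<in> coprime_factorizations N" "(u, v) \<notin> ?g ` ?O"
      then have uv: "u * v = N" "coprime u v" by (auto simp: coprime_factorizations_def)
      have pos: "u > 0" "v > 0" using uv assms by (auto intro: Nat.gr0I)
      have "u \<noteq> v" using uv assms by auto
      then consider "u < v" | "v < u" by linarith
      then show "(u, v) \<in> ?f ` ?O"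
      proof cases
        case 1
        then have "(int u, int v) \<in> ?O" using uv pos by (auto simp: ordered_factorizations_def)
        then show ?thesis by force
      next
        case 2
        then have "(int v, int u) \<in> ?O"
          using uv pos by (auto simp: ordered_factorizations_def coprime_commute mult.commute)
        then show ?thesis using *(2) by force
      qed
    qed
    show "?f ` ?O \<union> ?g ` ?O \<subseteq> coprime_factorizations N"
      using cop by (auto simp: ordered_factorizations_def coprime_factorizations_def
        coprime_commute mult.commute)
  qed
  moreover have "?f ` ?O \<inter> ?g ` ?O = {}" by (auto simp: ordered_factorizations_def)
  moreover have "card (?f ` ?O) = card ?O" "card (?g ` ?O) = card ?O"
    by (auto intro!: card_image simp: inj_on_def ordered_factorizations_def)
  moreover have "finite (coprime_factorizations N)" "card (coprime_factorizations N) = 2 ^ omega N"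
    using card_coprime_factorizations assms by simp_all
  ultimately show ?thesis by (simp add: card_Un_disjoint)
qed

lemma omega_square: "omega (n\<^sup>2) = omega n"
proof -
  have "{p. prime p \<and> p dvd n\<^sup>2} = {p. prime p \<and> p dvd n}"
    by (auto simp: prime_dvd_power_iff)
  then show ?thesis by (simp add: omega_def)
qed

lemma omega_double:
  assumes "even k"
  shows "omega (2 * k) = omega k"
proof -
  have "{p. prime p \<and> p dvd 2 * k} = {p. prime p \<and> p dvd k}"
    using assms by (auto simp: prime_dvd_mult_iff dest: primes_dvd_imp_eq[OF _ two_is_prime_nat])
  then show ?thesis by (simp add: omega_def)
qed

section \<open>Differences of coprime squares\<close>

definition coprime_square_differences :: "int \<Rightarrow> (int \<times> int) set" where
  "coprime_square_differences n = {(x, y). 0 < y \<and> y < x \<and> x\<^sup>2 - y\<^sup>2 = n\<^sup>2 \<and> coprime x y}"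

lemma coprime_sum_diff_imp:
  fixes u v :: int
  assumes "coprime (u + v) (v - u)"
  shows "coprime u v"
proof (rule coprimeI)
  fix d assume "d dvd u" "d dvd v"
  then have "d dvd u + v" "d dvd v - u" by simp_all
  then show "is_unit d" using assms coprime_common_divisor by blast
qed

lemma coprime_sum_diff:
  fixes u v :: int
  assumes "coprime u v" "odd (u + v)"
  shows "coprime (u + v) (v - u)"
proof (rule coprimeI)
  fix d assume d: "d dvd u + v" "d dvd v - u"
  then have "odd d" using assms(2) dvd_trans by blast
  then have "coprime d 2" by simp
  moreover have "d dvd 2 * u" "d dvd 2 * v"
    using dvd_diff[OF d] dvd_add[OF d] by simp_all
  ultimately have "d dvd u" "d dvd v" by (simp_all add: coprime_dvd_mult_right_iff)
  then show "is_unit d" using assms(1) coprime_common_divisor by blast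
qed

text \<open>The factors \<open>x - y\<close> and \<open>x + y\<close> of \<open>n^2\<close> are odd,
  so they are coprime exactly when \<open>x\<close> and \<open>y\<close> are.\<close>

lemma card_coprime_square_differences_odd:
  assumes "odd n"
  shows "card (coprime_square_differences n) = card (ordered_factorizations (n\<^sup>2))"
proof -
  let ?f = "\<lambda>(x, y). (x - y, x + y) :: int \<times> int"
  have "bij_betw ?f (coprime_square_differences n) (ordered_factorizations (n\<^sup>2))"
  proof (rule bij_betw_imageI)
    show "inj_on ?f (coprime_square_differences n)" by (auto simp: inj_on_def)
    show "?f ` coprime_square_differences n = ordered_factorizations (n\<^sup>2)"
    proof
      show "?f ` coprime_square_differences n \<subseteq> ordered_factorizations (n\<^sup>2)"
      proof clarify
        fix x y assume "(x, y) \<in> coprime_square_differences n"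
        then have *: "0 < y" "y < x" "x\<^sup>2 - y\<^sup>2 = n\<^sup>2" "coprime x y"
          by (auto simp: coprime_square_differences_def)
        have e: "(x - y) * (x + y) = n\<^sup>2" using *(3) by (simp add: algebra_simps power2_eq_square)
        then have "odd ((x - y) * (x + y))" using assms by simp
        then have "odd (x + y)" by simp
        then have "coprime (y + x) (x - y)" using *(4) by (intro coprime_sum_diff) (simp_all add: coprime_commute add.commute)
        then show "(x - y, x + y) \<in> ordered_factorizations (n\<^sup>2)"
          using * e by (simp add: ordered_factorizations_def coprime_commute add.commute)
      qed
      show "ordered_factorizations (n\<^sup>2) \<subseteq> ?f ` coprime_square_differences n"
      proof clarify
        fix u v assume "(u, v) \<in> ordered_factorizations (n\<^sup>2)"
        then have *: "0 < u" "u < v" "u * v = n\<^sup>2" "coprime u v"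
          by (auto simp: ordered_factorizations_def)
        have "odd (u * v)" using *(3) assms by simp
        then have "even (u + v)" by simp
        then obtain x where x: "u + v = 2 * x" by (rule evenE)
        define y where "y = v - x"
        have uv: "u = x - y" "v = x + y" using x by (simp_all add: y_def)
        have "coprime (y + x) (x - y)" using *(4) uv by (simp add: coprime_commute add.commute)
        then have "coprime y x" by (rule coprime_sum_diff_imp)
        then have "(x, y) \<in> coprime_square_differences n"
          using *(1-3) unfolding uv
          by (simp add: coprime_square_differences_def coprime_commute algebra_simps power2_eq_square)
        then show "(u, v) \<in> ?f ` coprime_square_differences n" using uv by force
      qed
    qed
  qed
  then show ?thesis by (rule bij_betw_same_card)
qed

text \<open>\<open>x\<close> and \<open>y\<close> have the same parity and are coprime, so both are
  odd; \<open>u\<close> and \<open>v\<close> are half their difference and half their sum.\<close>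

lemma coprime_square_difference_even:
  assumes "(x, y) \<in> coprime_square_differences (2 * k)"
  obtains u v where "x = u + v" "y = v - u" "(u, v) \<in> ordered_factorizations (k\<^sup>2)" "odd (u + v)"
proof -
  have *: "0 < y" "y < x" "x\<^sup>2 - y\<^sup>2 = 4 * k\<^sup>2" "coprime x y"
    using assms by (auto simp: coprime_square_differences_def power_mult_distrib)
  have "even (x\<^sup>2 - y\<^sup>2)" unfolding *(3) by simp
  then have "even x \<longleftrightarrow> even y" by simp
  moreover have "\<not> (even x \<and> even y)" using *(4) by (metis coprime_common_divisor odd_one)
  ultimately have odd: "odd x" "odd y" by auto
  then obtain u where u: "x - y = 2 * u" by (metis dvdE odd_even_add even_diff)
  define v where "v = x - u"
  have xy: "x = u + v" "y = v - u" using u by (simp_all add: v_def)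
  have "u * v = k\<^sup>2" using *(3) unfolding xy by (simp add: algebra_simps power2_eq_square)
  moreover have "coprime u v" using *(4) unfolding xy by (rule coprime_sum_diff_imp)
  ultimately have "(u, v) \<in> ordered_factorizations (k\<^sup>2)"
    using *(1,2) xy by (simp add: ordered_factorizations_def)
  then show ?thesis using that xy odd by blast
qed

text \<open>Factors of the odd number \<open>k^2\<close> have an even sum, whereas
  \<open>u + v\<close> is odd. This is the source of \<open>delta\<close>.\<close>

lemma coprime_square_differences_2_mod_4:
  assumes "odd k"
  shows "coprime_square_differences (2 * k) = {}"
proof -
  have False if xy: "(x, y) \<in> coprime_square_differences (2 * k)" for x y
  proof -
    obtain u v where "x = u + v" "y = v - u" "(u, v) \<in> ordered_factorizations (k\<^sup>2)" "odd (u + v)"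
      using coprime_square_difference_even[OF xy] .
    then have "u * v = k\<^sup>2" "odd (u + v)" by (auto simp: ordered_factorizations_def)
    then have "odd (u * v)" using assms by simp
    then show False using \<open>odd (u + v)\<close> by simp
  qed
  then show ?thesis by auto
qed

text \<open>Coprime factors of the even number \<open>k^2\<close> have opposite parity, so
  \<open>u + v\<close> and \<open>v - u\<close> are odd and again coprime.\<close>

lemma card_coprime_square_differences_0_mod_4:
  assumes "even k"
  shows "card (coprime_square_differences (2 * k)) = card (ordered_factorizations (k\<^sup>2))"
proof -
  let ?f = "\<lambda>(u, v). (u + v, v - u) :: int \<times> int"
  have "bij_betw ?f (ordered_factorizations (k\<^sup>2)) (coprime_square_differences (2 * k))"
  proof (rule bij_betw_imageI)
    show "inj_on ?f (ordered_factorizations (k\<^sup>2))" by (auto simp: inj_on_def)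
    show "?f ` ordered_factorizations (k\<^sup>2) = coprime_square_differences (2 * k)"
    proof
      show "?f ` ordered_factorizations (k\<^sup>2) \<subseteq> coprime_square_differences (2 * k)"
      proof clarify
        fix u v assume "(u, v) \<in> ordered_factorizations (k\<^sup>2)"
        then have *: "0 < u" "u < v" "u * v = k\<^sup>2" "coprime u v"
          by (auto simp: ordered_factorizations_def)
        have "even (u * v)" using *(3) assms by simp
        moreover have "\<not> (even u \<and> even v)" using *(4) by (metis coprime_common_divisor odd_one)
        ultimately have "odd (u + v)" by auto
        then have "coprime (u + v) (v - u)" using *(4) by (intro coprime_sum_diff)
        moreover have "(u + v)\<^sup>2 - (v - u)\<^sup>2 = (2 * k)\<^sup>2"
          unfolding power_mult_distrib *(3)[symmetric] by (simp add: algebra_simps power2_eq_square)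
        ultimately show "(u + v, v - u) \<in> coprime_square_differences (2 * k)"
          using * by (simp add: coprime_square_differences_def)
      qed
      show "coprime_square_differences (2 * k) \<subseteq> ?f ` ordered_factorizations (k\<^sup>2)"
      proof clarify
        fix x y assume "(x, y) \<in> coprime_square_differences (2 * k)"
        then obtain u v where "x = u + v" "y = v - u" "(u, v) \<in> ordered_factorizations (k\<^sup>2)"
          using coprime_square_difference_even by metis
        then show "(x, y) \<in> ?f ` ordered_factorizations (k\<^sup>2)" by force
      qed
    qed
  qed
  then show ?thesis using bij_betw_same_card by metis
qed

section \<open>Ambiguous forms and the main theorem\<close>

lemma card_diagonal_forms:
  assumes "n > 1"
  shows "card {(A, m, C) \<in> reduced_forms n. m = 0} = card (ordered_factorizations (n\<^sup>2))"
proof -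
  have "{(A, m, C) \<in> reduced_forms n. m = 0} = (\<lambda>(u, v). (u, 0, v)) ` ordered_factorizations (n\<^sup>2)"
    (is "?L = ?f ` ?O")
  proof
    show "?L \<subseteq> ?f ` ?O"
    proof clarify
      fix A C assume *: "(A, 0, C) \<in> reduced_forms n"
      note facts = reduced_form_facts[OF * assms]
      have "(A, C) \<in> ?O" using * facts
        by (auto simp: reduced_forms_def ordered_factorizations_def coprime_iff_gcd_eq_1)
      then show "(A, 0, C) \<in> ?f ` ?O" by force
    qed
  qed (auto simp: reduced_forms_def ordered_factorizations_def)
  moreover have "inj_on ?f ?O" by (auto simp: inj_on_def)
  ultimately show ?thesis by (simp add: card_image)
qed

lemma card_nondiagonal_ambiguous_forms:
  assumes "n > 1"
  shows "card {(A, m, C) \<in> reduced_forms n. A = 2 * m \<or> A = C} = card (coprime_square_differences n)"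
    (is "card ?L = card ?P")
proof -
  \<comment> \<open>\<open>n\<^sup>2 = (A - m) (A + m)\<close> if \<open>A = C\<close>, and \<open>n\<^sup>2 = m (2 C - m)\<close> if \<open>A = 2 m\<close>.\<close>
  let ?f = "\<lambda>(A, m, C). if A = C then (A, m) else (C, C - m)"
  \<comment> \<open>The threshold is the reduction inequality: for \<open>2 * y <= x\<close> the
    pair gives \<open>A = C = x\<close>, \<open>m = y\<close>; otherwise \<open>m = x - y\<close>
    satisfies \<open>2 * m < x\<close>, and \<open>(2 * m, m, x)\<close> is reduced.\<close>
  let ?g = "\<lambda>(x, y). if 2 * y \<le> x then (x, y, x) else (2 * (x - y), x - y, x)"
  have "bij_betw ?f ?L ?P"
  proof (rule bij_betw_byWitness[where f' = ?g])
    show "\<forall>T\<in>?L. ?g (?f T) = T"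
      by (auto simp: reduced_forms_def)
    show "\<forall>z\<in>?P. ?f (?g z) = z"
      by (auto simp: coprime_square_differences_def)
    show "?f ` ?L \<subseteq> ?P"
    proof (rule image_subsetI)
      fix T0 assume "T0 \<in> ?L"
      moreover obtain A m C where T0: "T0 = (A, m, C)" by (cases T0)
      ultimately have T: "(A, m, C) \<in> reduced_forms n" and amb: "A = 2 * m \<or> A = C" by auto
      have r: "0 \<le> m" "2 * m \<le> A" "A \<le> C" "A * C - m\<^sup>2 = n\<^sup>2" "gcd A (gcd m C) = 1"
        using T by (auto simp: reduced_forms_def)
      note facts = reduced_form_facts[OF T assms]
      have m: "m > 0" using amb facts r(1) by (cases "m = 0") auto
      show "?f T0 \<in> ?P"
      proof (cases "A = C")
        case True
        have "gcd C (gcd m C) = gcd C m" by (metis gcd.commute gcd.left_idem)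
        then have "coprime C m" using r(5) True by (simp add: coprime_iff_gcd_eq_1)
        then show ?thesis using True r m facts(1) T0
          by (simp add: coprime_square_differences_def power2_eq_square)
      next
        case False
        then have A: "A = 2 * m" using amb by simp
        have "coprime C (C - m)"
        proof (rule coprimeI)
          fix d assume "d dvd C" "d dvd C - m"
          then have "d dvd C - (C - m)" by (rule dvd_diff)
          then have "d dvd m" by simp
          then have "d dvd gcd A (gcd m C)" using \<open>d dvd C\<close> A by simp
          then show "is_unit d" using r(5) by simp
        qed
        moreover have "C\<^sup>2 - (C - m)\<^sup>2 = n\<^sup>2"
          using r(4) A by (simp add: algebra_simps power2_eq_square)
        ultimately show ?thesis using False A r m T0
          by (simp add: coprime_square_differences_def)
      qed
    qed
    show "?g ` ?P \<subseteq> ?L"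
    proof (rule image_subsetI)
      fix z assume "z \<in> ?P"
      moreover obtain x y where z: "z = (x, y)" by (cases z)
      ultimately have *: "0 < y" "y < x" "x\<^sup>2 - y\<^sup>2 = n\<^sup>2" "coprime x y"
        by (auto simp: coprime_square_differences_def)
      have unit: "is_unit d" if "d dvd x" "d dvd y" for d
        using *(4) that by (rule coprime_common_divisor)
      show "?g z \<in> ?L"
      proof (cases "2 * y \<le> x")
        case True
        have "gcd x (gcd y x) = 1"
          using *(4) by (simp add: gcd.commute gcd.left_commute coprime_iff_gcd_eq_1)
        then show ?thesis using True * z by (simp add: reduced_forms_def power2_eq_square)
      next
        case False
        have "coprime (2 * (x - y)) (gcd (x - y) x)"
        proof (rule coprimeI)
          fix d assume "d dvd gcd (x - y) x"
          then have "d dvd x" "d dvd x - y" by auto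
          then have "d dvd x" "d dvd x - (x - y)" by (blast intro: dvd_diff)+
          then show "is_unit d" using unit by simp
        qed
        moreover have "2 * (x - y) * x - (x - y)\<^sup>2 = n\<^sup>2"
          using *(3) by (simp add: algebra_simps power2_eq_square)
        ultimately show ?thesis using False * z
          by (simp add: reduced_forms_def)
      qed
    qed
  qed
  then show ?thesis by (rule bij_betw_same_card)
qed

text \<open>Diagonal forms contribute half of \<open>2 ^ omega n\<close>. The other ambiguous forms
  contribute as many again for odd \<open>n\<close> and for \<open>n\<close> divisible by 4, and
  none for \<open>n\<close> congruent to 2 modulo 4.\<close>

lemma card_ambiguous_forms:
  fixes n :: nat
  assumes "n > 1"
  shows "2 ^ delta n * card {T \<in> reduced_forms (int n). ambiguous_form T} = 2 ^ omega n"
proof -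
  let ?R = "reduced_forms (int n)"
  have n: "int n > 1" using assms by simp
  have fin: "finite ?R" using finite_reduced_forms n by simp
  let ?D = "{(A, m, C) \<in> ?R. m = 0}" and ?E = "{(A, m, C) \<in> ?R. A = 2 * m \<or> A = C}"
  have "{T \<in> ?R. ambiguous_form T} = ?D \<union> ?E" by (auto simp: ambiguous_form_def)
  moreover have "?D \<inter> ?E = {}" using reduced_form_facts[OF _ n] by fastforce
  moreover have "finite ?D" "finite ?E" by (rule finite_subset[OF _ fin], blast)+
  ultimately have card: "card {T \<in> ?R. ambiguous_form T} =
      card (ordered_factorizations ((int n)\<^sup>2)) + card (coprime_square_differences (int n))"
    by (simp only: card_Un_disjoint card_diagonal_forms[OF n] card_nondiagonal_ambiguous_forms[OF n])
  have sq: "2 * card (ordered_factorizations ((int k)\<^sup>2)) = 2 ^ omega k" if "k > 1" for k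
    using card_ordered_factorizations[of "k\<^sup>2"] that one_less_power[of k 2] by (simp add: omega_square)
  show ?thesis
  proof (cases "odd n")
    case True
    then have "delta n = 0" by (auto simp: delta_def cong_def) presburger
    then show ?thesis
      using sq[OF assms] card_coprime_square_differences_odd[of "int n"] True by (simp add: card)
  next
    case False
    then obtain k where k: "n = 2 * k" by auto
    then have ik: "2 * int k = int n" by simp
    show ?thesis
    proof (cases "even k")
      case True
      then have "k > 1" using assms k by (cases "k = 0") auto
      have "delta n = 0" using True k by (auto simp: delta_def cong_def elim!: evenE)
      then show ?thesis
        using sq[OF assms] sq[OF \<open>k > 1\<close>] True omega_double[OF True, folded k]
          card_coprime_square_differences_0_mod_4[of "int k", unfolded ik] by (simp add: card)
    next
      case False
      have "n mod 4 = 2" using False k by presburger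
      then have "delta n = 1" by (simp add: delta_def cong_def)
      then show ?thesis
        using sq[OF assms] coprime_square_differences_2_mod_4[of "int k", unfolded ik] False
        by (simp add: card)
    qed
  qed
qed

section \<open>From root quadruples to reduced forms\<close>

lemma descartes_quadruple_iff:
  "descartes_quadruple (- n, A + n, C + n, A + C + n - 2 * m) \<longleftrightarrow> A * C - m\<^sup>2 = n\<^sup>2"
proof -
  have "(- n + (A + n) + (C + n) + (A + C + n - 2 * m))\<^sup>2 -
      2 * ((- n)\<^sup>2 + (A + n)\<^sup>2 + (C + n)\<^sup>2 + (A + C + n - 2 * m)\<^sup>2) = 4 * (A * C - m\<^sup>2 - n\<^sup>2)"
    by (simp add: algebra_simps power2_eq_square)
  moreover have "y = x \<longleftrightarrow> a = b" if "x - y = 4 * (a - b)" for x y a b :: int using that by auto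
  ultimately show ?thesis unfolding descartes_quadruple_def prod.case by blast
qed

text \<open>The two gcds are compared through their prime divisors: the determinant equation yields
  a prime divisor of \<open>m^2\<close> from one of \<open>n\<close>, \<open>A\<close>,
  \<open>C\<close>, and one of \<open>n^2\<close> from one of \<open>A\<close>, \<open>m\<close>,
  \<open>C\<close>. The entry \<open>d\<close> contains only \<open>2 * m\<close>, so it could not
  detect \<open>m\<close> at the prime 2.\<close>

lemma primitive_quadruple_iff:
  assumes "A * C - m\<^sup>2 = n\<^sup>2"
  shows "primitive_quadruple (- n, A + n, C + n, A + C + n - 2 * m) \<longleftrightarrow> gcd A (gcd m C) = 1"
proof -
  let ?G = "Gcd {- n, A + n, C + n, A + C + n - 2 * m}"
  have *: "p dvd ?G \<longleftrightarrow> p dvd gcd A (gcd m C)" if p: "prime p" for p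
  proof
    assume "p dvd ?G"
    then have d: "p dvd n" "p dvd A + n" "p dvd C + n" by (auto simp: dvd_Gcd_iff)
    then have "p dvd A" "p dvd C" by (simp_all add: dvd_add_left_iff)
    moreover have "m\<^sup>2 = A * C - n\<^sup>2" using assms by simp
    then have "p dvd m\<^sup>2" using \<open>p dvd A\<close> d(1) by (simp add: power2_eq_square)
    then have "p dvd m" using p by (metis prime_dvd_power)
    ultimately show "p dvd gcd A (gcd m C)" by simp
  next
    assume "p dvd gcd A (gcd m C)"
    then have d: "p dvd A" "p dvd m" "p dvd C" by auto
    then have "p dvd A * C - m\<^sup>2" by (simp add: power2_eq_square)
    then have "p dvd n" using assms p by (metis prime_dvd_power)
    then show "p dvd ?G" using d by (simp add: dvd_Gcd_iff)
  qed
  have one: "G = 1 \<longleftrightarrow> (\<forall>p. prime p \<longrightarrow> \<not> p dvd G)" if "G \<ge> 0" for G :: int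
  proof
    assume none: "\<forall>p. prime p \<longrightarrow> \<not> p dvd G"
    have "G \<noteq> 0" using none two_is_prime_nat by (metis dvd_0_right prime_nat_int_transfer)
    then show "G = 1" using none that prime_divisor_exists[of G] by auto
  qed (auto dest: not_prime_unit)
  show ?thesis
  proof -
    have "?G = 1 \<longleftrightarrow> (\<forall>p. prime p \<longrightarrow> \<not> p dvd ?G)" by (rule one) simp
    also have "\<dots> \<longleftrightarrow> (\<forall>p. prime p \<longrightarrow> \<not> p dvd gcd A (gcd m C))" using * by blast
    also have "\<dots> \<longleftrightarrow> gcd A (gcd m C) = 1" by (rule one[symmetric]) simp
    finally show ?thesis by (simp only: primitive_quadruple_def prod.case)
  qed
qed

text \<open>The inequalities \<open>b <= c\<close>, \<open>c <= d\<close> and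
  \<open>d <= a + b + c\<close> become \<open>A <= C\<close>, \<open>2 * m <= A\<close> and
  \<open>0 <= m\<close>.\<close>

lemma root_quadruple_iff:
  assumes "n > 0"
  shows "root_quadruple (- n, A + n, C + n, A + C + n - 2 * m) \<and>
      primitive_quadruple (- n, A + n, C + n, A + C + n - 2 * m) \<longleftrightarrow> (A, m, C) \<in> reduced_forms n"
proof -
  have "root_quadruple (- n, A + n, C + n, A + C + n - 2 * m) \<longleftrightarrow>
      0 \<le> m \<and> 2 * m \<le> A \<and> A \<le> C \<and> A * C - m\<^sup>2 = n\<^sup>2"
    using assms unfolding root_quadruple_def prod.case descartes_quadruple_iff by auto
  then show ?thesis using primitive_quadruple_iff by (auto simp: reduced_forms_def)
qed

lemma N_root_star_eq_card_reduced_forms: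
  assumes "n > 0"
  shows "N_root_star (- n) = card (reduced_forms n)"
proof -
  let ?f = "\<lambda>(A, m, C). (- n, A + n, C + n, A + C + n - 2 * m)"
  have "{q. root_quadruple q \<and> primitive_quadruple q \<and> fst q = - n} = ?f ` reduced_forms n"
  proof
    show "{q. root_quadruple q \<and> primitive_quadruple q \<and> fst q = - n} \<subseteq> ?f ` reduced_forms n"
    proof clarify
      fix a b c d assume *: "root_quadruple (a, b, c, d)" "primitive_quadruple (a, b, c, d)"
        "fst (a, b, c, d) = - n"
      \<comment> \<open>The Descartes equation makes the sum of the entries even, so
        \<open>m\<close>, half of \<open>a + b + c - d\<close>, is an integer.\<close>
      define S where "S = a + b + c + d"
      have "S\<^sup>2 = 2 * (a\<^sup>2 + b\<^sup>2 + c\<^sup>2 + d\<^sup>2)"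
        using *(1) by (simp add: root_quadruple_def descartes_quadruple_def S_def)
      then have "even (S\<^sup>2)" by simp
      then have "even (a + b + c + d)" by (simp add: S_def)
      then have "even (a + b + c - d)" by simp
      then obtain m where m: "a + b + c - d = 2 * m" by (rule evenE)
      have eq: "(a, b, c, d) = ?f (b - n, m, c - n)" using *(3) m by auto
      have "root_quadruple (a, b, c, d) \<and> primitive_quadruple (a, b, c, d)" using * by simp
      then have "(b - n, m, c - n) \<in> reduced_forms n"
        unfolding eq prod.case by (simp only: root_quadruple_iff[OF assms])
      then show "(a, b, c, d) \<in> ?f ` reduced_forms n" unfolding eq by (rule imageI)
    qed
    show "?f ` reduced_forms n \<subseteq> {q. root_quadruple q \<and> primitive_quadruple q \<and> fst q = - n}"
      using root_quadruple_iff[OF assms] by auto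
  qed
  moreover have "inj_on ?f (reduced_forms n)" by (auto simp: inj_on_def)
  ultimately show ?thesis by (simp add: N_root_star_def card_image)
qed

theorem theorem4p3:
  fixes n :: nat
  assumes "n > 1"
  shows "real (N_root_star (- int n)) =
    real n / 4 * (\<Prod>p | prime p \<and> p dvd n. 1 - real_of_int (chi_m4 p) / real p)
    + 2 powi (int (omega n) - int (delta n) - 1)"
proof -
  define R a P where "R = card (reduced_forms (int n))"
    and "a = card {T \<in> reduced_forms (int n). ambiguous_form T}"
    and "P = (\<Prod>p | prime p \<and> p dvd n. 1 - real_of_int (chi_m4 p) / real p)"
  have "real (card (unit_points (int n)) + 2 * totient n * a) = real (4 * totient n * R)"
    using card_unit_points_eq[OF assms] by (simp add: R_def a_def)
  \<comment> \<open>Both sides carry the factor \<open>totient n\<close>: the number of points is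
    \<open>n * totient n * P\<close>.\<close>
  then have "real (totient n) * (real n * P + 2 * real a) = real (totient n) * (4 * real R)"
    using card_unit_points[of n] assms by (simp add: P_def algebra_simps)
  moreover have "real (totient n) \<noteq> 0" using assms by simp
  ultimately have R: "real n * P + 2 * real a = 4 * real R"
    by (simp only: mult_cancel_left) simp
  have a: "real (2 ^ delta n * a) = 2 ^ omega n"
    using card_ambiguous_forms[OF assms] by (simp add: a_def)
  \<comment> \<open>The exponent is -1 at \<open>n = 2\<close>, hence the expansion of
    \<open>powi\<close> as a quotient.\<close>
  have "(2 :: real) powi (int (omega n) - int (delta n) - 1) = 2 ^ omega n / 2 ^ delta n / 2"
    by (simp only: power_int_diff numeral_neq_zero simp_thms power_int_of_nat power_int_1_right)
  moreover have "real a / 2 = 2 ^ omega n / 2 ^ delta n / 2"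
    using a by (simp add: field_simps)
  ultimately have "real a / 2 = 2 powi (int (omega n) - int (delta n) - 1)" by (simp only:)
  moreover have "N_root_star (- int n) = R"
    using N_root_star_eq_card_reduced_forms[of "int n"] assms by (simp add: R_def)
  ultimately show ?thesis using R by (simp add: P_def)
qed

end
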